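(* Let $C$ be a bounded below chain complex of $\underline{\mathbb Z/2}$-modules which in each degree is a finite direct sum of copies of $F$ and $H$. Then $C$ is isomorphic (as a chain complex) to a direct sum of shifts of the complexes $A_k$, $B_r$, $H(n)$, $A_\infty$, $B_\infty$, and the contractible complexes $\mathbb D(F)$ and $\mathbb D(H)$, for various $k,r\geq 0$ and $n\in\mathbb Z$.
   Context: A $\underline{\mathbb Z/2}$-module is a $C_2$-Mackey functor $M$ (abelian groups $M_\Theta,M_\bullet$, maps $t\colon M_\Theta\to M_\Theta$, $p^*\colon M_\bullet\to M_\Theta$, $p_*\colon M_\Theta\to M_\bullet$ with $tp^*=p^*$, $p_*t=p_*$, $t^2=1$, $p^*p_*=1+t$) with both groups $\mathbb F_2$-vector spaces and $p_*p^*=0$. $H$: both groups $\mathbb F_2$, $t=p^*=\mathrm{id}$, $p_*=0$. $F$: $F_\Theta=\mathbb F_2^2$, $t$ the swap, $F_\bullet=\mathbb F_2$, $p_*(x,y)=x+y$, $p^*(z)=(z,z)$. Let $p\colon F\to H$, $p\colon H\to F$ be the unique nonzero maps and $u=1+t\colon F\to F$. Homological grading; $(\Sigma C)_i=C_{i-1}$. $A_k$ ($k\ge0$): $F$ in degrees $k,\dots,0$ with differentials $u$. $H(0)$: $H$ in degree $0$. For $n>0$: $H(-n)$ has $H$ in degree $n$ and $F$ in degrees $n-1,\dots,0$, differentials $p$ then $u$'s; $H(n)$ has $F$ in degrees $0,\dots,-(n-1)$ and $H$ in degree $-n$, differentials $u$'s then $p$. $B_r$ ($r\ge0$): $H$ in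 degree $0$, $F$ in degrees $-1,\dots,-(r+1)$, $H$ in degree $-(r+2)$, differentials $p,u,\dots,u,p$. $A_\infty$: $F$ in every degree $\geq 0$ with differentials $u$. $B_\infty$: $F$ in every degree $\geq1$ and $H$ in degree $0$, differentials $u$ between $F$'s and $p\colon F\to H$. $\mathbb D(P)$: $P\xrightarrow{\mathrm{id}}P$ in degrees $1,0$. *)

theory Defs
  imports Main "HOL-Library.Z2" "HOL-Library.Function_Algebras" "HOL-Library.Product_Plus"
begin

section \<open>Z/2-modules (C_2-Mackey functors of F_2-vector spaces with p_* p^* = 0)\<close>

text \<open>A Mackey functor M is given by carriers Top = M_Theta and Bot = M_bullet
  (subsets of ambient abelian groups, closed under + and containing 0),
  and maps tr = t, res = p^* : M_bullet -> M_Theta, ind = p_* : M_Theta -> M_bullet.\<close>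

record ('a, 'b) zmod =
  Top :: "'a set"
  Bot :: "'b set"
  tr  :: "'a \<Rightarrow> 'a"
  res :: "'b \<Rightarrow> 'a"
  ind :: "'a \<Rightarrow> 'b"

definition f2_space :: "'a::ab_group_add set \<Rightarrow> bool" where
  "f2_space S \<longleftrightarrow> 0 \<in> S \<and> (\<forall>x\<in>S. \<forall>y\<in>S. x + y \<in> S) \<and> (\<forall>x\<in>S. x + x = 0)"

definition additive_on :: "'a::ab_group_add set \<Rightarrow> ('a \<Rightarrow> 'c::ab_group_add) \<Rightarrow> bool" where
  "additive_on S f \<longleftrightarrow> (\<forall>x\<in>S. \<forall>y\<in>S. f (x + y) = f x + f y)"

definition is_zmod :: "('a::ab_group_add, 'b::ab_group_add) zmod \<Rightarrow> bool" where
  "is_zmod M \<longleftrightarrow>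
     f2_space (Top M) \<and> f2_space (Bot M) \<and>
     tr M ` Top M \<subseteq> Top M \<and> res M ` Bot M \<subseteq> Top M \<and> ind M ` Top M \<subseteq> Bot M \<and>
     additive_on (Top M) (tr M) \<and> additive_on (Bot M) (res M) \<and> additive_on (Top M) (ind M) \<and>
     (\<forall>z\<in>Bot M. tr M (res M z) = res M z) \<and>
     (\<forall>x\<in>Top M. ind M (tr M x) = ind M x) \<and>
     (\<forall>x\<in>Top M. tr M (tr M x) = x) \<and>
     (\<forall>x\<in>Top M. res M (ind M x) = x + tr M x) \<and>
     (\<forall>z\<in>Bot M. ind M (res M z) = 0)"

definition zhom :: "('a::ab_group_add, 'b::ab_group_add) zmod \<Rightarrow> ('c::ab_group_add, 'd::ab_group_add) zmod
                     \<Rightarrow> ('a \<Rightarrow> 'c) \<times> ('b \<Rightarrow> 'd) \<Rightarrow> bool" where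
  "zhom M N f \<longleftrightarrow>
     fst f ` Top M \<subseteq> Top N \<and> snd f ` Bot M \<subseteq> Bot N \<and>
     additive_on (Top M) (fst f) \<and> additive_on (Bot M) (snd f) \<and>
     (\<forall>x\<in>Top M. fst f (tr M x) = tr N (fst f x)) \<and>
     (\<forall>z\<in>Bot M. fst f (res M z) = res N (snd f z)) \<and>
     (\<forall>x\<in>Top M. snd f (ind M x) = ind N (fst f x))"

definition ziso :: "('a::ab_group_add, 'b::ab_group_add) zmod \<Rightarrow> ('c::ab_group_add, 'd::ab_group_add) zmod
                     \<Rightarrow> ('a \<Rightarrow> 'c) \<times> ('b \<Rightarrow> 'd) \<Rightarrow> bool" where
  "ziso M N f \<longleftrightarrow> zhom M N f \<and> bij_betw (fst f) (Top M) (Top N) \<and> bij_betw (snd f) (Bot M) (Bot N)"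

definition is_complex :: "(int \<Rightarrow> ('a::ab_group_add, 'b::ab_group_add) zmod)
                          \<Rightarrow> (int \<Rightarrow> ('a \<Rightarrow> 'a) \<times> ('b \<Rightarrow> 'b)) \<Rightarrow> bool" where
  "is_complex C d \<longleftrightarrow>
     (\<forall>i. is_zmod (C i)) \<and> (\<forall>i. zhom (C i) (C (i - 1)) (d i)) \<and>
     (\<forall>i. \<forall>x\<in>Top (C i). fst (d (i - 1)) (fst (d i) x) = 0) \<and>
     (\<forall>i. \<forall>z\<in>Bot (C i). snd (d (i - 1)) (snd (d i) z) = 0)"

definition bounded_below :: "(int \<Rightarrow> ('a::ab_group_add, 'b::ab_group_add) zmod) \<Rightarrow> bool" where
  "bounded_below C \<longleftrightarrow> (\<exists>N. \<forall>i<N. Top (C i) = {0} \<and> Bot (C i) = {0})"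

definition complex_iso :: "(int \<Rightarrow> ('a::ab_group_add, 'b::ab_group_add) zmod) \<Rightarrow> (int \<Rightarrow> ('a \<Rightarrow> 'a) \<times> ('b \<Rightarrow> 'b))
     \<Rightarrow> (int \<Rightarrow> ('c::ab_group_add, 'd::ab_group_add) zmod) \<Rightarrow> (int \<Rightarrow> ('c \<Rightarrow> 'c) \<times> ('d \<Rightarrow> 'd))
     \<Rightarrow> (int \<Rightarrow> ('a \<Rightarrow> 'c) \<times> ('b \<Rightarrow> 'd)) \<Rightarrow> bool" where
  "complex_iso C d C' d' f \<longleftrightarrow>
     (\<forall>i. ziso (C i) (C' i) (f i)) \<and>
     (\<forall>i. \<forall>x\<in>Top (C i). fst (f (i - 1)) (fst (d i) x) = fst (d' i) (fst (f i) x)) \<and>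
     (\<forall>i. \<forall>z\<in>Bot (C i). snd (f (i - 1)) (snd (d i) z) = snd (d' i) (snd (f i) z))"

definition zF :: "(bit \<times> bit, bit) zmod" where
  "zF = \<lparr>Top = UNIV, Bot = UNIV, tr = (\<lambda>(x, y). (y, x)), res = (\<lambda>z. (z, z)), ind = (\<lambda>(x, y). x + y)\<rparr>"

text \<open>H: both levels F_2 (Theta-level modelled as F_2 \<times> {0}), t = id, p^* = id, p_* = 0.\<close>
definition zH :: "(bit \<times> bit, bit) zmod" where
  "zH = \<lparr>Top = {(x, 0) | x. True}, Bot = UNIV, tr = id, res = (\<lambda>z. (z, 0)), ind = (\<lambda>_. 0)\<rparr>"

definition zZ :: "(bit \<times> bit, bit) zmod" where
  "zZ = \<lparr>Top = {0}, Bot = {0}, tr = id, res = (\<lambda>_. 0), ind = (\<lambda>_. 0)\<rparr>"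

text \<open>u = 1 + t : F -> F\<close>
definition map_u :: "((bit \<times> bit) \<Rightarrow> (bit \<times> bit)) \<times> (bit \<Rightarrow> bit)" where
  "map_u = ((\<lambda>(x, y). (x + y, x + y)), (\<lambda>_. 0))"

text \<open>the unique nonzero map p : F -> H\<close>
definition map_pFH :: "((bit \<times> bit) \<Rightarrow> (bit \<times> bit)) \<times> (bit \<Rightarrow> bit)" where
  "map_pFH = ((\<lambda>(x, y). (x + y, 0)), (\<lambda>_. 0))"

text \<open>the unique nonzero map p : H -> F\<close>
definition map_pHF :: "((bit \<times> bit) \<Rightarrow> (bit \<times> bit)) \<times> (bit \<Rightarrow> bit)" where
  "map_pHF = ((\<lambda>(x, y). (x, x)), (\<lambda>z. z))"

definition map_id :: "((bit \<times> bit) \<Rightarrow> (bit \<times> bit)) \<times> (bit \<Rightarrow> bit)" where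
  "map_id = (id, id)"

definition map_zero :: "((bit \<times> bit) \<Rightarrow> (bit \<times> bit)) \<times> (bit \<Rightarrow> bit)" where
  "map_zero = ((\<lambda>_. 0), (\<lambda>_. 0))"

datatype shape = SZ | SF | SH

fun shape_mod :: "shape \<Rightarrow> (bit \<times> bit, bit) zmod" where
  "shape_mod SZ = zZ" | "shape_mod SF = zF" | "shape_mod SH = zH"

datatype kind = KA nat | KB nat | KH int | KAinf | KBinf | KDF | KDH

fun kshape :: "kind \<Rightarrow> int \<Rightarrow> shape" where
  "kshape (KA k) i = (if 0 \<le> i \<and> i \<le> int k then SF else SZ)"
| "kshape (KB r) i =
     (if i = 0 then SH
      else if -(int r + 1) \<le> i \<and> i \<le> -1 then SF
      else if i = -(int r + 2) then SH else SZ)"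
| "kshape (KH n) i =
     (if n = 0 then (if i = 0 then SH else SZ)
      else if n < 0 then (if i = -n then SH else if 0 \<le> i \<and> i \<le> -n - 1 then SF else SZ)
      else (if i = -n then SH else if -(n - 1) \<le> i \<and> i \<le> 0 then SF else SZ))"
| "kshape KAinf i = (if 0 \<le> i then SF else SZ)"
| "kshape KBinf i = (if 1 \<le> i then SF else if i = 0 then SH else SZ)"
| "kshape KDF i = (if i = 0 \<or> i = 1 then SF else SZ)"
| "kshape KDH i = (if i = 0 \<or> i = 1 then SH else SZ)"

definition kdiff :: "kind \<Rightarrow> int \<Rightarrow> ((bit \<times> bit) \<Rightarrow> (bit \<times> bit)) \<times> (bit \<Rightarrow> bit)" where
  "kdiff k i =
     (case (kshape k i, kshape k (i - 1)) of
        (SF, SF) \<Rightarrow> (if k = KDF then map_id else map_u)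
      | (SF, SH) \<Rightarrow> map_pFH
      | (SH, SF) \<Rightarrow> map_pHF
      | (SH, SH) \<Rightarrow> map_id
      | _ \<Rightarrow> map_zero)"

definition dsum :: "(nat \<Rightarrow> (bit \<times> bit, bit) zmod) \<Rightarrow> (nat \<Rightarrow> bit \<times> bit, nat \<Rightarrow> bit) zmod" where
  "dsum M = \<lparr>Top = {v. (\<forall>j. v j \<in> Top (M j)) \<and> finite {j. v j \<noteq> 0}},
             Bot = {w. (\<forall>j. w j \<in> Bot (M j)) \<and> finite {j. w j \<noteq> 0}},
             tr = (\<lambda>v j. tr (M j) (v j)),
             res = (\<lambda>w j. res (M j) (w j)),
             ind = (\<lambda>v j. ind (M j) (v j))\<rparr>"

definition FH_sum :: "nat \<Rightarrow> nat \<Rightarrow> (nat \<Rightarrow> bit \<times> bit, nat \<Rightarrow> bit) zmod" where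
  "FH_sum a b = dsum (\<lambda>j. if j < a then zF else if j < a + b then zH else zZ)"

definition fin_FH :: "('a::ab_group_add, 'b::ab_group_add) zmod \<Rightarrow> bool" where
  "fin_FH M \<longleftrightarrow> (\<exists>a b f. ziso M (FH_sum a b) f)"

definition std_sum_mod :: "nat set \<Rightarrow> (nat \<Rightarrow> kind) \<Rightarrow> (nat \<Rightarrow> int) \<Rightarrow> int
                            \<Rightarrow> (nat \<Rightarrow> bit \<times> bit, nat \<Rightarrow> bit) zmod" where
  "std_sum_mod J \<kappa> \<sigma> i = dsum (\<lambda>j. if j \<in> J then shape_mod (kshape (\<kappa> j) (i - \<sigma> j)) else zZ)"

definition std_sum_diff :: "nat set \<Rightarrow> (nat \<Rightarrow> kind) \<Rightarrow> (nat \<Rightarrow> int) \<Rightarrow> int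
                            \<Rightarrow> ((nat \<Rightarrow> bit \<times> bit) \<Rightarrow> (nat \<Rightarrow> bit \<times> bit)) \<times> ((nat \<Rightarrow> bit) \<Rightarrow> (nat \<Rightarrow> bit))" where
  "std_sum_diff J \<kappa> \<sigma> i =
     ((\<lambda>v j. if j \<in> J then fst (kdiff (\<kappa> j) (i - \<sigma> j)) (v j) else 0),
      (\<lambda>w j. if j \<in> J then snd (kdiff (\<kappa> j) (i - \<sigma> j)) (w j) else 0))"

end

theory Submission
  imports "HOL-Library.Countable_Set" Defs
begin

(* Defs is imported last so that dsum is not taken for Old_Datatype.dsum. *)

text \<open>
  A finite sum of copies of \<open>F\<close> and \<open>H\<close> is free on generators at the two levels, and a direct sum
  decomposition of the required kind amounts to a choice of generators in every degree such that the
  differential \<open>d\<close> maps each generator to zero or, via \<open>1\<close>, \<open>u\<close> or \<open>p\<close>, to a generator, no generator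
  being hit twice: the strands of such a choice are the summands.

  Such generators are found for the part of the complex below degree \<open>n\<close> by induction on \<open>n\<close>. There is a flag on the
  cycles of degree \<open>n\<close> such that every basis of the cycles adapted to the flag extends to a normal form below.
  For the next degree \<open>M = C (n + 1)\<close>, a basis adapted simultaneously to the flag and to
  \<open>p\<^sub>* d M\<^sub>\<Theta> \<subseteq> d M\<^sub>\<bullet> \<subseteq> (p\<^sup>*)\<^sup>-\<^sup>1 d M\<^sub>\<Theta>\<close> is lifted to \<open>M\<close>.
  Passing to degree \<open>n + 1\<close> may change all lower generators, but over \<open>F\<^sub>2\<close> there are only finitely many choices in
  each degree, so Koenig's lemma provides one that works in all degrees.
\<close>

section \<open>Linear algebra over the field with two elements\<close>

text \<open>Two flags of a finite vector space always have a common adapted basis; three in general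
  do not. The new differential already contributes one flag, so everything that the lower degrees
  impose on the cycles has to be compressed into a single other one. Its order comes from the
  permitted changes of generators. If \<open>e\<close> and \<open>f\<close> generate copies of
  \<open>F\<close> and the differential of \<open>f\<close> lies over an earlier step than that of
  \<open>e\<close>, then replacing \<open>e\<close> by \<open>e + f\<close> changes the target of
  \<open>e\<close> by an earlier element only. The new flag is therefore the old one pulled back
  along the differential. Cycles that lift to cycles at the \<open>Top\<close> level come first.
  Generators of \<open>H\<close> come last: \<open>ind\<close> of an element can be added to them,
  but adding one of them to \<open>ind e\<close> can lead out of the image of \<open>ind\<close>.
  Prescribed lifts enter because \<open>ind e\<close> determines \<open>e\<close> only up to the
  image of \<open>res\<close>, whereas an identity between two copies of \<open>F\<close> must hit
  the chosen generator itself.\<close>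

definition span2 :: "'a::ab_group_add set \<Rightarrow> 'a set" where
  "span2 X = {\<Sum>Y |Y. finite Y \<and> Y \<subseteq> X}"

text \<open>Over the field with two elements a linear combination is a sum over a finite subset, so
  no scalars occur. Only the carriers are vector spaces, not the ambient groups; this is why the
  lemmas below carry a space \<open>S\<close> around \<open>X\<close>.\<close>

definition indep2 :: "'a::ab_group_add set \<Rightarrow> bool" where
  "indep2 X \<longleftrightarrow> (\<forall>Y. finite Y \<longrightarrow> Y \<subseteq> X \<longrightarrow> \<Sum>Y = 0 \<longrightarrow> Y = {})"

definition basis2 :: "'a::ab_group_add set \<Rightarrow> 'a set \<Rightarrow> bool" where
  "basis2 X S \<longleftrightarrow> X \<subseteq> S \<and> indep2 X \<and> span2 X = S"

lemma span2_sumI: "finite Y \<Longrightarrow> Y \<subseteq> X \<Longrightarrow> \<Sum>Y \<in> span2 X"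
  unfolding span2_def by blast

lemma span2E:
  assumes "x \<in> span2 X"
  obtains Y where "finite Y" "Y \<subseteq> X" "x = \<Sum>Y"
  using assms unfolding span2_def by blast

lemma indep2D: "indep2 X \<Longrightarrow> finite Y \<Longrightarrow> Y \<subseteq> X \<Longrightarrow> \<Sum>Y = 0 \<Longrightarrow> Y = {}"
  unfolding indep2_def by blast

lemma f2_zero: "f2_space S \<Longrightarrow> 0 \<in> S"
  and f2_add: "f2_space S \<Longrightarrow> x \<in> S \<Longrightarrow> y \<in> S \<Longrightarrow> x + y \<in> S"
  and f2_double: "f2_space S \<Longrightarrow> x \<in> S \<Longrightarrow> x + x = 0"
  by (auto simp: f2_space_def)

lemma f2_eq: "f2_space S \<Longrightarrow> x \<in> S \<Longrightarrow> y \<in> S \<Longrightarrow> x + y = 0 \<Longrightarrow> x = y"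
  by (metis add_right_cancel f2_double)

lemma f2_cancel: "f2_space S \<Longrightarrow> x \<in> S \<Longrightarrow> x + (x + y) = y"
  by (metis add.assoc add_0 f2_double)

lemma f2_sum: "f2_space S \<Longrightarrow> (\<And>a. a \<in> A \<Longrightarrow> f a \<in> S) \<Longrightarrow> sum f A \<in> S"
  by (induction A rule: infinite_finite_induct) (auto simp: f2_zero f2_add)

lemma f2_subspace:
  assumes "f2_space S" "T \<subseteq> S" "0 \<in> T" "\<And>x y. x \<in> T \<Longrightarrow> y \<in> T \<Longrightarrow> x + y \<in> T"
  shows "f2_space T"
  using assms by (auto simp: f2_space_def)

lemma f2_Int: "f2_space S \<Longrightarrow> f2_space T \<Longrightarrow> f2_space (S \<inter> T)"
  by (auto simp: f2_space_def)

lemma f2_singleton: "f2_space {0}"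
  by (auto simp: f2_space_def)

lemma additive_onD: "additive_on S f \<Longrightarrow> x \<in> S \<Longrightarrow> y \<in> S \<Longrightarrow> f (x + y) = f x + f y"
  by (auto simp: additive_on_def)

lemma additive_zero: "f2_space S \<Longrightarrow> additive_on S f \<Longrightarrow> f 0 = 0"
  by (metis add_cancel_right_right additive_onD f2_zero)

lemma additive_sum:
  assumes "f2_space S" "additive_on S h" "\<And>a. a \<in> A \<Longrightarrow> f a \<in> S"
  shows "h (sum f A) = (\<Sum>a\<in>A. h (f a))"
  using assms(3)
  by (induction A rule: infinite_finite_induct)
    (auto simp: additive_zero[OF assms(1,2)] additive_onD[OF assms(2)] f2_sum[OF assms(1)])

lemma f2_image:
  assumes "f2_space S" "additive_on S h" "h ` S \<subseteq> T" "f2_space T"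
  shows "f2_space (h ` S)"
proof (rule f2_subspace[OF assms(4,3)])
  show "0 \<in> h ` S" using additive_zero[OF assms(1,2)] f2_zero[OF assms(1)] by force
  show "x + y \<in> h ` S" if "x \<in> h ` S" "y \<in> h ` S" for x y
    using that additive_onD[OF assms(2), symmetric] f2_add[OF assms(1)] by auto
qed

text \<open>The common elements are counted twice and cancel in characteristic 2. This is what
  closes subset sums under addition.\<close>

lemma sum_symdiff:
  assumes "f2_space S" "finite A" "finite B" "A \<subseteq> S"
  shows "\<Sum>A + \<Sum>B = \<Sum>(A - B \<union> (B - A))"
proof -
  have "\<Sum>A = \<Sum>(A - B) + \<Sum>(A \<inter> B)"
    using assms sum.Int_Diff[of A "\<lambda>x. x" B] by (simp add: add.commute)
  moreover have "\<Sum>B = \<Sum>(A \<inter> B) + \<Sum>(B - A)"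
    using assms sum.Int_Diff[of B "\<lambda>x. x" A] by (simp add: Int_commute)
  moreover have "\<Sum>(A \<inter> B) + (\<Sum>(A \<inter> B) + \<Sum>(B - A)) = \<Sum>(B - A)"
    by (rule f2_cancel[OF assms(1) f2_sum[OF assms(1)]]) (use assms(4) in auto)
  moreover have "\<Sum>(A - B \<union> (B - A)) = \<Sum>(A - B) + \<Sum>(B - A)"
    using assms by (intro sum.union_disjoint) auto
  ultimately show ?thesis by (simp only: add.assoc)
qed

lemma span2_mono: "X \<subseteq> Y \<Longrightarrow> span2 X \<subseteq> span2 Y"
  unfolding span2_def by blast

lemma span2_base: "x \<in> X \<Longrightarrow> x \<in> span2 X"
  unfolding span2_def by (auto intro!: exI[of _ "{x}"])

lemma span2_zero: "0 \<in> span2 X"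
  unfolding span2_def by (auto intro!: exI[of _ "{}"])

lemma span2_sub: "f2_space S \<Longrightarrow> X \<subseteq> S \<Longrightarrow> span2 X \<subseteq> S"
  unfolding span2_def by (auto intro!: f2_sum)

lemma span2_f2:
  assumes "f2_space S" "X \<subseteq> S"
  shows "f2_space (span2 X)"
proof (rule f2_subspace[OF assms(1) span2_sub[OF assms] span2_zero])
  fix x y assume "x \<in> span2 X" "y \<in> span2 X"
  then obtain A B where "finite A" "A \<subseteq> X" "x = \<Sum>A" "finite B" "B \<subseteq> X" "y = \<Sum>B"
    unfolding span2_def by blast
  then have "x + y = \<Sum>(A - B \<union> (B - A))" "finite (A - B \<union> (B - A))" "A - B \<union> (B - A) \<subseteq> X"
    using sum_symdiff[OF assms(1)] assms(2) by auto
  then show "x + y \<in> span2 X" unfolding span2_def by blast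
qed

lemma span2_sum:
  assumes "f2_space S" "X \<subseteq> S" "\<And>a. a \<in> A \<Longrightarrow> f a \<in> span2 X"
  shows "sum f A \<in> span2 X"
  using f2_sum[OF span2_f2[OF assms(1,2)]] assms(3) by blast

lemma indep2_unique:
  assumes "f2_space S" "X \<subseteq> S" "indep2 X" "finite A" "finite B" "A \<subseteq> X" "B \<subseteq> X" "\<Sum>A = \<Sum>B"
  shows "A = B"
proof -
  have "\<Sum>A + \<Sum>B = 0"
    using assms f2_sum[OF assms(1), of B "\<lambda>x. x"] by (auto intro!: f2_double[OF assms(1)])
  then have "\<Sum>(A - B \<union> (B - A)) = 0"
    using sum_symdiff[OF assms(1,4,5)] assms by auto
  then have "A - B \<union> (B - A) = {}"
    using assms(3-7) unfolding indep2_def by (auto dest!: spec[of _ "A - B \<union> (B - A)"])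
  then show ?thesis by auto
qed

lemma indep2_in_span:
  assumes "f2_space S" "X \<subseteq> S" "indep2 X" "finite A" "A \<subseteq> X" "Z \<subseteq> X" "\<Sum>A \<in> span2 Z"
  shows "A \<subseteq> Z"
proof -
  obtain W where "finite W" "W \<subseteq> Z" "\<Sum>A = \<Sum>W" using assms(7) unfolding span2_def by auto
  then show ?thesis using indep2_unique[OF assms(1-4), of W] assms(5,6) by blast
qed

lemma indep2_nonzero: "indep2 X \<Longrightarrow> 0 \<notin> X"
  unfolding indep2_def by (drule spec[of _ "{0}"]) auto

lemma indep2_empty: "indep2 {}"
  by (simp add: indep2_def)

lemma indep2_mono: "indep2 X \<Longrightarrow> Y \<subseteq> X \<Longrightarrow> indep2 Y"
  unfolding indep2_def by (meson subset_trans)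

lemma span2_empty: "span2 {} = {0}"
  unfolding span2_def by auto

text \<open>Assumption \<open>*\<close> is independence of \<open>Y - X\<close> modulo the span of
  \<open>X\<close>. Allowing \<open>X\<close> and \<open>Y\<close> to overlap spares a disjointness
  proof at each use.\<close>

lemma indep2_Un:
  assumes "f2_space S" "X \<subseteq> S" "Y \<subseteq> S" "indep2 X"
    and *: "\<And>B. finite B \<Longrightarrow> B \<subseteq> Y - X \<Longrightarrow> \<Sum>B \<in> span2 X \<Longrightarrow> B = {}"
  shows "indep2 (X \<union> Y)"
  unfolding indep2_def
proof (intro allI impI)
  fix Z assume Z: "finite Z" "Z \<subseteq> X \<union> Y" "\<Sum>Z = 0"
  have "\<Sum>Z = \<Sum>(Z \<inter> X) + \<Sum>(Z - X)"
    using sum.Int_Diff[OF Z(1), of "\<lambda>x. x" X] by simp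
  moreover have "\<Sum>(Z \<inter> X) \<in> S" by (rule f2_sum[OF assms(1)]) (use assms(2) in auto)
  moreover have "\<Sum>(Z - X) \<in> S" by (rule f2_sum[OF assms(1)]) (use Z(2) assms(3) in auto)
  ultimately have eq: "\<Sum>(Z \<inter> X) = \<Sum>(Z - X)" using f2_eq[OF assms(1)] Z(3) by metis
  have "\<Sum>(Z \<inter> X) \<in> span2 X" by (rule span2_sumI) (use Z(1) in auto)
  then have "Z - X = {}" unfolding eq by (intro *) (use Z(1,2) in auto)
  then have "\<Sum>(Z \<inter> X) = 0" using eq by (metis sum.empty)
  then have "Z \<inter> X = {}" using indep2D[OF assms(4), of "Z \<inter> X"] Z(1) by blast
  then show "Z = {}" using \<open>Z - X = {}\<close> by auto
qed

lemma indep2_insert: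
  assumes "f2_space S" "X \<subseteq> S" "x \<in> S" "indep2 X" "x \<notin> span2 X"
  shows "indep2 (insert x X)"
proof -
  have *: "B = {}" if B: "finite B" "B \<subseteq> {x} - X" "\<Sum>B \<in> span2 X" for B
  proof (rule ccontr)
    assume "B \<noteq> {}"
    then have "B = {x}" using B(2) by blast
    then show False using B(3) assms(5) by simp
  qed
  have "indep2 (X \<union> {x})"
    by (rule indep2_Un[OF assms(1,2) _ assms(4) *]) (simp_all add: assms(3))
  then show ?thesis by simp
qed

lemma indep2_extend:
  assumes S: "f2_space S" "finite S" and X: "X \<subseteq> S" "indep2 X"
  shows "\<exists>X'. X \<subseteq> X' \<and> basis2 X' S"
  using X
proof (induction "card (S - X)" arbitrary: X rule: less_induct)
  case less
  show ?case
  proof (cases "span2 X = S")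
    case True
    then show ?thesis using less.prems unfolding basis2_def by blast
  next
    case False
    then obtain x where x: "x \<in> S" "x \<notin> span2 X" using span2_sub[OF S(1) less.prems(1)] by auto
    then have "x \<notin> X" using span2_base by auto
    then have "card (S - insert x X) < card (S - X)"
      using x S(2) by (intro psubset_card_mono) auto
    then obtain X' where "insert x X \<subseteq> X'" "basis2 X' S"
      using less.hyps[of "insert x X"] indep2_insert[OF S(1) less.prems(1) x(1) less.prems(2) x(2)] x less.prems by auto
    then show ?thesis by auto
  qed
qed

text \<open>The basis is built one step of the flag at a time. The elements of \<open>Y\<close> that
  are new in step \<open>Suc n\<close> are independent modulo \<open>F n\<close>, because by the
  last assumption a sum of elements of \<open>Y\<close> lying in \<open>F n\<close> only involves
  elements of \<open>Y\<close> in \<open>F n\<close>. Applied to a flag cut down to a subspace, with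
  a basis of a smaller subspace as \<open>Y\<close>, this produces bases adapted to two flags at
  once.\<close>

lemma flag_extend:
  fixes F :: "nat \<Rightarrow> 'a::ab_group_add set"
  assumes F: "\<And>j. f2_space (F j)" "\<And>j. finite (F j)" "\<And>j. F j \<subseteq> F (Suc j)"
    and Y: "Y \<subseteq> F m" "indep2 Y" "\<And>j. j \<le> m \<Longrightarrow> F j \<inter> span2 Y \<subseteq> span2 (Y \<inter> F j)"
  shows "\<exists>X. Y \<subseteq> X \<and> basis2 X (F m) \<and> (\<forall>j\<le>m. span2 (X \<inter> F j) = F j)"
proof -
  have mono: "F i \<subseteq> F j" if "i \<le> j" for i j
    using lift_Suc_mono_le[of F, OF F(3) that] .
  have "n \<le> m \<Longrightarrow> \<exists>X. Y \<inter> F n \<subseteq> X \<and> basis2 X (F n) \<and> (\<forall>j\<le>n. span2 (X \<inter> F j) = F j)" for n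
  proof (induction n)
    case 0
    obtain X where "Y \<inter> F 0 \<subseteq> X" "basis2 X (F 0)"
      using indep2_extend[OF F(1,2), of "Y \<inter> F 0" 0] indep2_mono[OF Y(2), of "Y \<inter> F 0"] by auto
    then show ?case by (auto simp: basis2_def Int_absorb2)
  next
    case (Suc n)
    then obtain X where X: "Y \<inter> F n \<subseteq> X" "basis2 X (F n)" "\<And>j. j \<le> n \<Longrightarrow> span2 (X \<inter> F j) = F j" by auto
    have XS: "X \<subseteq> F (Suc n)" using X(2) F(3)[of n] by (auto simp: basis2_def)
    have "indep2 (X \<union> (Y \<inter> F (Suc n)))"
    proof (rule indep2_Un[OF F(1)[of "Suc n"]])
      show "X \<subseteq> F (Suc n)" "indep2 X" using XS X(2) by (auto simp: basis2_def)
      fix B assume B: "finite B" "B \<subseteq> Y \<inter> F (Suc n) - X" "\<Sum>B \<in> span2 X"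
      have "\<Sum>B \<in> span2 Y" using B by (intro span2_sumI) auto
      then have "\<Sum>B \<in> span2 (Y \<inter> F n)" using B X(2) Y(3)[of n] Suc.prems by (auto simp: basis2_def)
      then have "B \<subseteq> Y \<inter> F n"
        using indep2_in_span[OF F(1) Y(1,2) B(1), of "Y \<inter> F n"] B by auto
      then show "B = {}" using B X by auto
    qed auto
    then obtain X' where X': "X \<union> (Y \<inter> F (Suc n)) \<subseteq> X'" "basis2 X' (F (Suc n))"
      using indep2_extend[OF F(1,2), of "X \<union> (Y \<inter> F (Suc n))" "Suc n"] XS by auto
    have "span2 (X' \<inter> F j) = F j" if "j \<le> Suc n" for j
    proof (cases "j = Suc n")
      case True
      then show ?thesis using X' by (auto simp: basis2_def Int_absorb2)
    next
      case False
      then have "span2 (X \<inter> F j) = F j" using X(3) that by auto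
      moreover have "span2 (X \<inter> F j) \<subseteq> span2 (X' \<inter> F j)" using X' by (intro span2_mono) auto
      moreover have "span2 (X' \<inter> F j) \<subseteq> F j" by (rule span2_sub[OF F(1)]) auto
      ultimately show ?thesis by auto
    qed
    then show ?case using X' by auto
  qed
  from this[of m] show ?thesis using Y(1) by (auto simp: Int_absorb2)
qed

text \<open>Rank-nullity with explicit bases: adding the lift of \<open>h x\<close> to
  \<open>x\<close> leaves an element of the kernel. Below, \<open>h\<close> is the differential at
  the \<open>Bot\<close> level.\<close>

lemma basis2_kernel_image:
  assumes S: "f2_space S" and h: "additive_on S h" and T: "f2_space T" "h ` S \<subseteq> T"
    and K: "basis2 K {x \<in> S. h x = 0}" and Y: "basis2 Y (h ` S)"
    and g: "\<And>y. y \<in> Y \<Longrightarrow> g y \<in> S \<and> h (g y) = y"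
  shows "basis2 (K \<union> g ` Y) S"
proof -
  have inj: "inj_on g Y" using g by (metis inj_onI)
  have KS: "K \<subseteq> S" "\<And>x. x \<in> K \<Longrightarrow> h x = 0" using K by (auto simp: basis2_def)
  have h0: "h x = 0" if "x \<in> span2 K" for x
    using that K by (auto simp: basis2_def)
  have hsum: "h (\<Sum>(g ` A)) = \<Sum>A" if "A \<subseteq> Y" for A
  proof -
    have "h (\<Sum>(g ` A)) = h (\<Sum>a\<in>A. g a)" using sum.reindex[OF inj_on_subset[OF inj that], of "\<lambda>x. x"] by simp
    also have "\<dots> = (\<Sum>a\<in>A. h (g a))" using g that by (intro additive_sum[OF S h]) auto
    also have "\<dots> = \<Sum>A" using g that by (intro sum.cong) auto
    finally show ?thesis .
  qed
  have "indep2 (K \<union> g ` Y)"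
  proof (rule indep2_Un[OF S KS(1)])
    fix B assume B: "finite B" "B \<subseteq> g ` Y - K" "\<Sum>B \<in> span2 K"
    then obtain A where A: "A \<subseteq> Y" "B = g ` A" by (metis Diff_subset subset_image_iff subset_trans)
    then have "\<Sum>A = 0" using hsum h0 B(3) by metis
    moreover have "finite A" using A B(1) inj by (metis finite_imageD inj_on_subset)
    ultimately show "B = {}" using Y A indep2D[of Y A] by (auto simp: basis2_def)
  qed (use g K in \<open>auto simp: basis2_def\<close>)
  moreover have sub: "K \<union> g ` Y \<subseteq> S" using KS g by auto
  moreover have "x \<in> span2 (K \<union> g ` Y)" if x: "x \<in> S" for x
  proof -
    have "h x \<in> span2 Y" using Y x by (auto simp: basis2_def)
    then obtain A where A: "A \<subseteq> Y" "finite A" "h x = \<Sum>A" by (auto simp: span2_def)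
    let ?y = "\<Sum>(g ` A)"
    have yS: "?y \<in> S" using A g by (intro f2_sum[OF S]) auto
    have "h (?y + x) = h x + h x" using additive_onD[OF h yS x] hsum A by simp
    also have "\<dots> = 0" using f2_double[OF T(1)] T(2) x by auto
    finally have "?y + x \<in> span2 K" using K f2_add[OF S yS x] by (auto simp: basis2_def)
    then have "?y + x \<in> span2 (K \<union> g ` Y)" using span2_mono[of K "K \<union> g ` Y"] by auto
    moreover have "?y \<in> span2 (K \<union> g ` Y)" using A by (intro span2_sumI) auto
    ultimately have "?y + (?y + x) \<in> span2 (K \<union> g ` Y)" using f2_add[OF span2_f2[OF S sub]] by blast
    then show ?thesis using f2_cancel[OF S yS] by simp
  qed
  ultimately show ?thesis using span2_sub[OF S sub] by (auto simp: basis2_def)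
qed

text \<open>A point of level \<open>n\<close> is kept if paths from it reach every later level. If
  no point of a level qualified, the maximum of the finitely many depths of failure would contradict
  the existence of a longer path. The predicate \<open>P\<close> in \<open>pigeon\<close> restricts
  the choice to successors of the point chosen before.\<close>

lemma koenig:
  fixes R :: "nat \<Rightarrow> 'x \<Rightarrow> 'x \<Rightarrow> bool"
  assumes fin: "\<And>n. finite (A n)"
    and paths: "\<And>n. \<exists>p. (\<forall>k\<le>n. p k \<in> A k) \<and> (\<forall>k<n. R k (p k) (p (Suc k)))"
  shows "\<exists>p. \<forall>k. p k \<in> A k \<and> R k (p k) (p (Suc k))"
proof -
  define ext where "ext n m x \<longleftrightarrow>
    (\<exists>p. p n = x \<and> (\<forall>k. n \<le> k \<and> k \<le> m \<longrightarrow> p k \<in> A k) \<and> (\<forall>k. n \<le> k \<and> k < m \<longrightarrow> R k (p k) (p (Suc k))))" for n m x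
  have ext_anti: "ext n m' x" if "ext n m x" "m' \<le> m" for n m m' x
  proof -
    obtain p where "p n = x" "\<forall>k. n \<le> k \<and> k \<le> m \<longrightarrow> p k \<in> A k"
      "\<forall>k. n \<le> k \<and> k < m \<longrightarrow> R k (p k) (p (Suc k))" using \<open>ext n m x\<close> unfolding ext_def by auto
    then show ?thesis unfolding ext_def using \<open>m' \<le> m\<close> by (intro exI[of _ p]) auto
  qed
  have pigeon: "\<exists>x\<in>A n. P x \<and> (\<forall>m\<ge>n. ext n m x)" if "\<And>m. m \<ge> n \<Longrightarrow> \<exists>x\<in>A n. P x \<and> ext n m x" for n P
  proof (rule ccontr)
    assume "\<not> ?thesis"
    then have "\<forall>x\<in>A n. \<exists>m\<ge>n. P x \<longrightarrow> \<not> ext n m x" by blast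
    then obtain f where f: "\<And>x. x \<in> A n \<Longrightarrow> f x \<ge> n \<and> (P x \<longrightarrow> \<not> ext n (f x) x)" by metis
    define m where "m = Max (insert n (f ` A n))"
    have "m \<ge> n" "\<And>x. x \<in> A n \<Longrightarrow> f x \<le> m" unfolding m_def using fin by auto
    then show False using that[of m] f ext_anti by blast
  qed
  have "\<exists>p. \<forall>n. (p n \<in> A n \<and> (\<forall>m\<ge>n. ext n m (p n))) \<and> R n (p n) (p (Suc n))"
  proof (rule dependent_nat_choice)
    have "\<exists>x\<in>A 0. True \<and> ext 0 m x" for m
      using paths[of m] unfolding ext_def by auto
    then show "\<exists>x. x \<in> A 0 \<and> (\<forall>m\<ge>0. ext 0 m x)" using pigeon[of 0 "\<lambda>_. True"] by auto
  next
    fix x n assume x: "x \<in> A n \<and> (\<forall>m\<ge>n. ext n m x)"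
    have "\<exists>y\<in>A (Suc n). R n x y \<and> ext (Suc n) m y" if "m \<ge> Suc n" for m
    proof -
      have "ext n m x" using x that by simp
      then obtain p where "p n = x" "\<forall>k. n \<le> k \<and> k \<le> m \<longrightarrow> p k \<in> A k"
        "\<forall>k. n \<le> k \<and> k < m \<longrightarrow> R k (p k) (p (Suc k))" unfolding ext_def by auto
      then show ?thesis using that unfolding ext_def by (intro bexI[of _ "p (Suc n)"]) auto
    qed
    then show "\<exists>y. (y \<in> A (Suc n) \<and> (\<forall>m\<ge>Suc n. ext (Suc n) m y)) \<and> R n x y"
      using pigeon[of "Suc n" "R n x"] by auto
  qed
  then show ?thesis by auto
qed

section \<open>Generators adapted to the differential\<close>

text \<open>The only properties of finite sums of \<open>F\<close> and \<open>H\<close> that the argument needs: \<open>p\<^sup>*\<close> is injective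
  and its image is the kernel of \<open>p\<^sub>*\<close>.\<close>

definition nice :: "('a::ab_group_add, 'b::ab_group_add) zmod \<Rightarrow> bool" where
  "nice M \<longleftrightarrow> finite (Top M) \<and> finite (Bot M) \<and> inj_on (res M) (Bot M) \<and>
     (\<forall>x\<in>Top M. ind M x = 0 \<longrightarrow> x \<in> res M ` Bot M)"

locale nice_complex =
  fixes C :: "int \<Rightarrow> ('a::ab_group_add, 'b::ab_group_add) zmod"
    and d :: "int \<Rightarrow> ('a \<Rightarrow> 'a) \<times> ('b \<Rightarrow> 'b)"
  assumes cx: "is_complex C d" and nice: "nice (C i)"
begin

abbreviation T where "T i \<equiv> Top (C i)"
abbreviation B where "B i \<equiv> Bot (C i)"
abbreviation dT where "dT i \<equiv> fst (d i)"
abbreviation dB where "dB i \<equiv> snd (d i)"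
abbreviation io where "io i \<equiv> ind (C i)"
abbreviation rho where "rho i \<equiv> res (C i)"

lemma zm: "is_zmod (C i)" and zh: "zhom (C i) (C (i - 1)) (d i)"
  using cx unfolding is_complex_def by auto

lemma T_f2: "f2_space (T i)" and B_f2: "f2_space (B i)"
  and io_add: "additive_on (T i) (io i)" and rho_add: "additive_on (B i) (rho i)"
  and tr_add: "additive_on (T i) (tr (C i))"
  using zm[of i] unfolding is_zmod_def by auto

lemma io_in: "x \<in> T i \<Longrightarrow> io i x \<in> B i" and rho_in: "z \<in> B i \<Longrightarrow> rho i z \<in> T i"
  and tr_in: "x \<in> T i \<Longrightarrow> tr (C i) x \<in> T i"
  and io_rho: "z \<in> B i \<Longrightarrow> io i (rho i z) = 0"
  and rho_io: "x \<in> T i \<Longrightarrow> rho i (io i x) = x + tr (C i) x"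
  and io_tr: "x \<in> T i \<Longrightarrow> io i (tr (C i) x) = io i x"
  and tr_rho: "z \<in> B i \<Longrightarrow> tr (C i) (rho i z) = rho i z"
  and tr_tr: "x \<in> T i \<Longrightarrow> tr (C i) (tr (C i) x) = x"
  using zm[of i] unfolding is_zmod_def by auto

lemma dT_add: "additive_on (T i) (dT i)" and dB_add: "additive_on (B i) (dB i)"
  using zh[of i] unfolding zhom_def by auto

lemma dT_in: "x \<in> T i \<Longrightarrow> dT i x \<in> T (i - 1)" and dB_in: "z \<in> B i \<Longrightarrow> dB i z \<in> B (i - 1)"
  and dT_rho: "z \<in> B i \<Longrightarrow> dT i (rho i z) = rho (i - 1) (dB i z)"
  and dB_io: "x \<in> T i \<Longrightarrow> dB i (io i x) = io (i - 1) (dT i x)"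
  and dT_tr: "x \<in> T i \<Longrightarrow> dT i (tr (C i) x) = tr (C (i - 1)) (dT i x)"
  using zh[of i] unfolding zhom_def by auto

lemma dT_dT: "x \<in> T i \<Longrightarrow> dT (i - 1) (dT i x) = 0" and dB_dB: "z \<in> B i \<Longrightarrow> dB (i - 1) (dB i z) = 0"
  using cx unfolding is_complex_def by auto

lemma rho_inj: "z \<in> B i \<Longrightarrow> w \<in> B i \<Longrightarrow> rho i z = rho i w \<Longrightarrow> z = w"
  and io_ker: "x \<in> T i \<Longrightarrow> io i x = 0 \<Longrightarrow> \<exists>z\<in>B i. x = rho i z"
  and fin_T: "finite (T i)" and fin_B: "finite (B i)"
  using nice[of i] unfolding nice_def inj_on_def by auto

lemmas io_0 = additive_zero[OF T_f2 io_add] and rho_0 = additive_zero[OF B_f2 rho_add]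
  and dT_0 = additive_zero[OF T_f2 dT_add] and dB_0 = additive_zero[OF B_f2 dB_add]

text \<open>A generator can be hit from above only if its representative lies in \<open>Q\<close>.
  This is weaker than having a lift in \<open>ZT\<close>: if \<open>e\<close> is sent down by
  \<open>u\<close> or \<open>p\<close>, then \<open>io i e\<close> is in \<open>Q i\<close> although
  \<open>e\<close> is not a cycle.\<close>

definition Q where "Q i = {z \<in> B i. dB i z = 0}"
definition ZT where "ZT i = {x \<in> T i. dT i x = 0}"

lemma Q_f2: "f2_space (Q i)"
  by (rule f2_subspace[OF B_f2[of i]])
    (auto simp: Q_def dB_0 f2_zero[OF B_f2] f2_add[OF B_f2] additive_onD[OF dB_add])

lemma Q_B: "Q i \<subseteq> B i" by (auto simp: Q_def)

text \<open>The elements of \<open>E\<close> freely generate the \<open>F\<close>-summands and those of \<open>G\<close> the \<open>H\<close>-summands of \<open>C i\<close>.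
  Freeness can be tested on the \<open>\<bullet>\<close>-level alone, where a generator \<open>e\<close> of \<open>F\<close> is represented by \<open>p\<^sub>* e\<close>.\<close>

definition gens where
  "gens i E G \<longleftrightarrow> E \<subseteq> T i \<and> inj_on (io i) E \<and> io i ` E \<inter> G = {} \<and>
     basis2 (io i ` E \<union> G) (B i) \<and> span2 (io i ` E) = io i ` T i"

text \<open>\<open>tgt i E' G' E x' x\<close>: the differential sends the generator represented by \<open>x'\<close> to the generator
  represented by \<open>x\<close>, through the identity, \<open>u\<close> or one of the two maps \<open>p\<close>.\<close>

definition tgt where
  "tgt i E' G' E x' x \<longleftrightarrow>
     (\<exists>e\<in>E'. x' = io i e \<and> (dT i e \<in> E \<and> x = io (i - 1) (dT i e) \<or> dT i e = rho (i - 1) x)) \<or>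
     x' \<in> G' \<and> x = dB i x'"

text \<open>The condition \<open>dT i e = rho (i - 1) x\<close> covers \<open>u\<close> and
  \<open>p\<close> together: \<open>rho\<close> of \<open>io e'\<close> is
  \<open>e' + tr e'\<close>, while for \<open>x\<close> in \<open>G\<close> it is the
  \<open>Top\<close> element of that copy of \<open>H\<close>. For generators of \<open>H\<close>
  the \<open>Bot\<close> level suffices, since \<open>dT (rho g) = rho (dB g)\<close>.\<close>

definition linked where
  "linked i E' G' E G \<longleftrightarrow>
     (\<forall>e\<in>E'. dT i e = 0 \<or> dT i e \<in> E \<or> (\<exists>x\<in>io (i - 1) ` E \<union> G. dT i e = rho (i - 1) x)) \<and>
     (\<forall>g\<in>G'. dB i g = 0 \<or> dB i g \<in> io (i - 1) ` E \<union> G) \<and>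
     (\<forall>x\<in>io (i - 1) ` E \<union> G. \<forall>x' x''. tgt i E' G' E x' x \<longrightarrow> tgt i E' G' E x'' x \<longrightarrow> x' = x'')"

text \<open>The flag \<open>F\<close> on the cycles records how the strands reaching degree \<open>i\<close> may be added to one another
  without destroying the normal form below: any basis adapted to it is part of a normal form.
  Asking for all adapted bases, with prescribed lifts, is what makes the induction on \<open>i\<close> go through.\<close>

definition flagged where
  "flagged i \<longleftrightarrow> (\<exists>(F :: nat \<Rightarrow> 'b set) m. F 0 = {0} \<and> (\<forall>j. f2_space (F j)) \<and> (\<forall>j. F j \<subseteq> F (Suc j)) \<and>
     (\<forall>j. F j \<subseteq> Q i) \<and> F m = Q i \<and>
     (\<forall>X l. basis2 X (Q i) \<longrightarrow> (\<forall>j\<le>m. span2 (X \<inter> F j) = F j) \<longrightarrow>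
        (\<forall>x\<in>X \<inter> io i ` ZT i. l x \<in> ZT i \<and> io i (l x) = x) \<longrightarrow>
        (\<exists>E G. (\<forall>k\<le>i. gens k (E k) (G k) \<and> linked k (E k) (G k) (E (k - 1)) (G (k - 1))) \<and>
               X \<subseteq> io i ` E i \<union> G i \<and> l ` (X \<inter> io i ` ZT i) \<subseteq> E i)))"

text \<open>The basis \<open>X'\<close> of the new cycles is given and cannot be modified, so the
  freedom lies in the basis \<open>X\<close> of the old cycles handed to the induction hypothesis.
  \<open>X\<close> must contain every target that \<open>X'\<close> and the generators outside the
  cycles require, and must still be adapted to the old flag. That the targets required by
  \<open>X'\<close> fit the old flag is what adaptedness of \<open>X'\<close> to the new one
  guarantees.\<close>

lemma flagged_step:
  assumes "flagged (i - 1)"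
  shows "flagged i"
proof -
  define k where "k = i - 1"
  obtain F m where F: "F 0 = {0}" "\<And>j. f2_space (F j)" "\<And>j. F j \<subseteq> F (Suc j)" "\<And>j. F j \<subseteq> Q k" "F m = Q k"
    and IH: "\<forall>X l. basis2 X (Q k) \<longrightarrow> (\<forall>j\<le>m. span2 (X \<inter> F j) = F j) \<longrightarrow>
        (\<forall>x\<in>X \<inter> io k ` ZT k. l x \<in> ZT k \<and> io k (l x) = x) \<longrightarrow>
        (\<exists>E G. (\<forall>k'\<le>k. gens k' (E k') (G k') \<and> linked k' (E k') (G k') (E (k' - 1)) (G (k' - 1))) \<and>
               X \<subseteq> io k ` E k \<union> G k \<and> l ` (X \<inter> io k ` ZT k) \<subseteq> E k)"
    using assms unfolding flagged_def k_def[symmetric] by (elim exE conjE) blast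
  note dT_in' = dT_in[of _ i, folded k_def] and dB_in' = dB_in[of _ i, folded k_def]
    and dT_rho' = dT_rho[of _ i, folded k_def] and dB_io' = dB_io[of _ i, folded k_def]
    and dT_dT' = dT_dT[of _ i, folded k_def] and dB_dB' = dB_dB[of _ i, folded k_def]
  have Fm: "F a \<subseteq> F b" if "a \<le> b" for a b using lift_Suc_mono_le[of F, OF F(3) that] .
  have FB: "F j \<subseteq> B k" for j using F(4)[of j] Q_B by blast
  txt \<open>The new flag orders the cycles \<open>p\<^sub>* y\<close> by the step of the old flag over which \<open>y\<close> lies.\<close>
  define L where "L j = {y \<in> T i. dT i y \<in> rho k ` F j}" for j
  have L_f2: "f2_space (L j)" for j
  proof (rule f2_subspace[OF T_f2[of i]])
    show "0 \<in> L j" using f2_zero[OF T_f2] f2_zero[OF F(2)] dT_0 rho_0 by (force simp: L_def)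
    fix x y assume "x \<in> L j" "y \<in> L j"
    then obtain a b where ab: "x \<in> T i" "y \<in> T i" "a \<in> F j" "b \<in> F j" "dT i x = rho k a" "dT i y = rho k b"
      by (auto simp: L_def)
    then have "dT i (x + y) = rho k (a + b)"
      using additive_onD[OF dT_add] additive_onD[OF rho_add] FB by (metis subsetD)
    then show "x + y \<in> L j" using ab f2_add[OF T_f2] f2_add[OF F(2)] by (auto simp: L_def)
  qed (auto simp: L_def)
  have LT: "L j \<subseteq> T i" for j by (auto simp: L_def)
  define F' where "F' n = (case n of 0 \<Rightarrow> {0} | Suc j \<Rightarrow> if j \<le> m then io i ` L j else Q i)" for n
  have F'0: "F' 0 = {0}" and F'S: "\<And>j. j \<le> m \<Longrightarrow> F' (Suc j) = io i ` L j" and F'Q: "F' (Suc (Suc m)) = Q i"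
    by (auto simp: F'_def)
  have ioL_Q: "io i ` L j \<subseteq> Q i" for j
  proof
    fix z assume "z \<in> io i ` L j"
    then obtain y a where y: "y \<in> T i" "z = io i y" "a \<in> F j" "dT i y = rho k a" by (auto simp: L_def)
    then have "dB i z = io k (rho k a)" using dB_io' by simp
    also have "\<dots> = 0" using y FB by (intro io_rho) auto
    finally show "z \<in> Q i" using y io_in by (auto simp: Q_def)
  qed
  have L_mono: "L j \<subseteq> L (Suc j)" for j using F(3)[of j] by (auto simp: L_def)
  have ioL_f2: "f2_space (io i ` L j)" for j
  proof (rule f2_image[OF L_f2 _ _ B_f2[of i]])
    show "additive_on (L j) (io i)" using io_add[of i] LT by (auto simp: additive_on_def subset_eq)
    show "io i ` L j \<subseteq> B i" using ioL_Q Q_B by blast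
  qed
  have F'_f2: "f2_space (F' n)" for n
    by (auto simp: F'_def f2_singleton Q_f2 ioL_f2 split: nat.split)
  have zero_ioL: "0 \<in> io i ` L j" for j using f2_zero[OF ioL_f2] .
  have F'_mono: "F' n \<subseteq> F' (Suc n)" for n
    using zero_ioL f2_zero[OF Q_f2] ioL_Q L_mono
    by (auto simp: F'_def image_mono split: nat.split)
  have F'_Q: "F' n \<subseteq> Q i" for n
    using f2_zero[OF Q_f2] ioL_Q by (auto simp: F'_def split: nat.split)
  have L0: "L 0 = ZT i" by (auto simp: L_def F(1) rho_0 ZT_def)
  show ?thesis
    unfolding flagged_def
  proof (intro exI[of _ F'] exI[of _ "Suc (Suc m)"] conjI allI impI F'0 F'_f2 F'_mono F'_Q F'Q)
    fix X' l' assume X': "basis2 X' (Q i)" "\<forall>j\<le>Suc (Suc m). span2 (X' \<inter> F' j) = F' j"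
      "\<forall>x\<in>X' \<inter> io i ` ZT i. l' x \<in> ZT i \<and> io i (l' x) = x"
    have X'Q: "X' \<subseteq> Q i" "indep2 X'" using X'(1) by (auto simp: basis2_def)
    have spL: "span2 (X' \<inter> io i ` L j) = io i ` L j" if "j \<le> m" for j
      using X'(2)[rule_format, of "Suc j"] F'S that by auto
    define W where "W = X' \<inter> io i ` L m"
    \<comment> \<open>\<open>y\<close> lifts \<open>x\<close> to a generator of \<open>F\<close> and
      \<open>q\<close> is the target of \<open>y\<close> under \<open>u\<close> or \<open>p\<close>.
      One choice has to be as early in the old flag as \<open>x\<close> permits, for all
      \<open>j\<close> at once, and must agree with the prescribed lift where there is one.\<close>
    define P where "P x y q \<longleftrightarrow> y \<in> T i \<and> io i y = x \<and> dT i y = rho k q \<and> q \<in> Q k \<and>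
      (\<forall>j\<le>m. x \<in> io i ` L j \<longrightarrow> q \<in> F j) \<and> (x \<in> io i ` ZT i \<longrightarrow> y = l' x)" for x y q
    have "\<exists>y q. P x y q" if x: "x \<in> W" for x
    proof (cases "x \<in> io i ` ZT i")
      case True
      then have "l' x \<in> ZT i \<and> io i (l' x) = x" using X'(3) x by (auto simp: W_def)
      then show ?thesis using f2_zero[OF F(2)] f2_zero[OF Q_f2] rho_0[of k]
        by (intro exI[of _ "l' x"] exI[of _ 0]) (auto simp: ZT_def P_def)
    next
      case False
      \<comment> \<open>At the least \<open>j\<close> the target lies in \<open>F j\<close>, hence
        in every later step, and no earlier step is demanded.\<close>
      define j where "j = (LEAST j. x \<in> io i ` L j)"
      have j: "x \<in> io i ` L j" unfolding j_def by (rule LeastI[of _ m]) (use x in \<open>auto simp: W_def\<close>)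
      then obtain y q where y: "y \<in> T i" "io i y = x" "q \<in> F j" "dT i y = rho k q" by (auto simp: L_def)
      have "q \<in> F j'" if "x \<in> io i ` L j'" for j'
        using Fm[of j j'] Least_le[of "\<lambda>j. x \<in> io i ` L j", OF that] y(3) by (auto simp: j_def)
      then show ?thesis using y F(4)[of j] False unfolding P_def by (intro exI[of _ y] exI[of _ q]) auto
    qed
    then obtain y q where y: "\<And>x. x \<in> W \<Longrightarrow> y x \<in> T i" "\<And>x. x \<in> W \<Longrightarrow> io i (y x) = x"
        "\<And>x. x \<in> W \<Longrightarrow> dT i (y x) = rho k (q x)" "\<And>x. x \<in> W \<Longrightarrow> q x \<in> Q k"
        "\<And>x j. x \<in> W \<Longrightarrow> j \<le> m \<Longrightarrow> x \<in> io i ` L j \<Longrightarrow> q x \<in> F j"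
        "\<And>x. x \<in> W \<Longrightarrow> x \<in> io i ` ZT i \<Longrightarrow> y x = l' x"
    proof -
      assume *: thesis if "\<And>x. x \<in> W \<Longrightarrow> y x \<in> T i" "\<And>x. x \<in> W \<Longrightarrow> io i (y x) = x"
        "\<And>x. x \<in> W \<Longrightarrow> dT i (y x) = rho k (q x)" "\<And>x. x \<in> W \<Longrightarrow> q x \<in> Q k"
        "\<And>x j. x \<in> W \<Longrightarrow> j \<le> m \<Longrightarrow> x \<in> io i ` L j \<Longrightarrow> q x \<in> F j"
        "\<And>x. x \<in> W \<Longrightarrow> x \<in> io i ` ZT i \<Longrightarrow> y x = l' x" for y q
      obtain y q where "\<And>x. x \<in> W \<Longrightarrow> P x (y x) (q x)" using \<open>\<And>x. x \<in> W \<Longrightarrow> \<exists>y q. P x y q\<close> by metis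
      then show thesis unfolding P_def by (intro *[of y q]) blast+
    qed
    have qB: "q x \<in> B k" if "x \<in> W" for x using y(4)[OF that] Q_B by blast
    txt \<open>In a normal form \<open>c0\<close>, \<open>c1\<close>, \<open>c2\<close> are spanned by the generators hit from degree \<open>i\<close> by the identity
      of \<open>F\<close>, additionally by an \<open>H\<close>, and additionally by an \<open>F\<close> through \<open>u\<close> or \<open>p\<close>.\<close>
    define c0 where "c0 = io k ` dT i ` T i"
    define c1 where "c1 = dB i ` B i"
    define c2 where "c2 = {z \<in> Q k. rho k z \<in> dT i ` T i}"
    have c01: "c0 \<subseteq> c1" unfolding c0_def c1_def using io_in dB_io'[symmetric] by auto
    have c1Q: "c1 \<subseteq> Q k" unfolding c1_def Q_def using dB_in' dB_dB' by auto
    have c12: "c1 \<subseteq> c2" unfolding c2_def using c1Q dT_rho'[symmetric] rho_in by (auto simp: c1_def)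
    have c1_f2: "f2_space c1" unfolding c1_def
      by (rule f2_image[OF B_f2 dB_add _ B_f2[of k]]) (use dB_in' in auto)
    have dTT_f2: "f2_space (dT i ` T i)"
      by (rule f2_image[OF T_f2 dT_add _ T_f2[of k]]) (use dT_in' in auto)
    have c0_f2: "f2_space c0" unfolding c0_def
    proof (rule f2_image[OF dTT_f2 _ _ B_f2[of k]])
      show "additive_on (dT i ` T i) (io k)" using io_add[of k] dT_in' by (auto simp: additive_on_def)
    qed (use dT_in' io_in in auto)
    have c2_f2: "f2_space c2"
    proof (rule f2_subspace[OF Q_f2[of k]])
      show "c2 \<subseteq> Q k" by (auto simp: c2_def)
      show "0 \<in> c2" using f2_zero[OF c1_f2] c12 by auto
      fix a b assume ab: "a \<in> c2" "b \<in> c2"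
      have "rho k (a + b) = rho k a + rho k b"
        by (rule additive_onD[OF rho_add]) (use ab Q_B in \<open>auto simp: c2_def\<close>)
      then show "a + b \<in> c2"
        using ab f2_add[OF Q_f2] f2_add[OF dTT_f2, of "rho k a" "rho k b"] by (simp add: c2_def)
    qed
    have finS: "finite S" if "S \<subseteq> Q k" for S using that Q_B fin_B by (meson finite_subset)
    \<comment> \<open>The common basis for \<open>F\<close> and
      \<open>c0 \<subseteq> c1 \<subseteq> c2 \<subseteq> Q k\<close> arises by extending
      \<open>Y0\<close> to \<open>Y1\<close> to \<open>Y2\<close> to \<open>X\<close>. Only the
      passage to \<open>c2\<close> leaves no freedom: there the elements \<open>q x\<close> dictated
      by \<open>X'\<close> are added, and their adaptedness has to be proved.\<close>
    obtain Y0 where Y0: "basis2 Y0 c0" "\<And>j. j \<le> m \<Longrightarrow> span2 (Y0 \<inter> F j) = F j \<inter> c0"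
    proof -
      have "\<exists>Y. {} \<subseteq> Y \<and> basis2 Y (F m \<inter> c0) \<and> (\<forall>j\<le>m. span2 (Y \<inter> (F j \<inter> c0)) = F j \<inter> c0)"
      proof (rule flag_extend)
        show "f2_space (F j \<inter> c0)" for j using F(2) c0_f2 by (rule f2_Int)
        show "finite (F j \<inter> c0)" for j using F(4)[of j] by (intro finS) auto
        show "F j \<inter> c0 \<subseteq> F (Suc j) \<inter> c0" for j using F(3)[of j] by auto
      qed (auto simp: indep2_empty span2_empty)
      then obtain Y where Y: "basis2 Y (F m \<inter> c0)" "\<forall>j\<le>m. span2 (Y \<inter> (F j \<inter> c0)) = F j \<inter> c0" by auto
      have "F m \<inter> c0 = c0" using F(5) c01 c1Q by auto
      moreover have "Y \<inter> (F j \<inter> c0) = Y \<inter> F j" for j using Y by (auto simp: basis2_def)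
      ultimately show ?thesis using that Y by auto
    qed
    obtain Y1 where Y1: "Y0 \<subseteq> Y1" "basis2 Y1 c1" "\<And>j. j \<le> m \<Longrightarrow> span2 (Y1 \<inter> F j) = F j \<inter> c1"
    proof -
      have "\<exists>Y. Y0 \<subseteq> Y \<and> basis2 Y (F m \<inter> c1) \<and> (\<forall>j\<le>m. span2 (Y \<inter> (F j \<inter> c1)) = F j \<inter> c1)"
      proof (rule flag_extend)
        show "f2_space (F j \<inter> c1)" for j using F(2) c1_f2 by (rule f2_Int)
        show "finite (F j \<inter> c1)" for j using F(4)[of j] by (intro finS) auto
        show "F j \<inter> c1 \<subseteq> F (Suc j) \<inter> c1" for j using F(3)[of j] by auto
        show "Y0 \<subseteq> F m \<inter> c1" using Y0(1) c01 c1Q F(5) by (auto simp: basis2_def)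
        show "indep2 Y0" using Y0(1) by (auto simp: basis2_def)
        fix j assume j: "j \<le> m"
        have "Y0 \<inter> (F j \<inter> c1) = Y0 \<inter> F j" using Y0(1) c01 by (auto simp: basis2_def)
        then show "F j \<inter> c1 \<inter> span2 Y0 \<subseteq> span2 (Y0 \<inter> (F j \<inter> c1))"
          using Y0(2)[OF j] Y0(1) by (auto simp: basis2_def)
      qed
      then obtain Y where Y: "Y0 \<subseteq> Y" "basis2 Y (F m \<inter> c1)" "\<forall>j\<le>m. span2 (Y \<inter> (F j \<inter> c1)) = F j \<inter> c1" by auto
      have "F m \<inter> c1 = c1" using F(5) c1Q by auto
      moreover have "Y \<inter> (F j \<inter> c1) = Y \<inter> F j" for j using Y by (auto simp: basis2_def)
      ultimately show ?thesis using that Y by auto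
    qed
    \<comment> \<open>For \<open>x\<close> in \<open>W\<close> outside \<open>V\<close> the lift is
      a cycle and \<open>q x = 0\<close>, so exactly the elements of \<open>V\<close> need a
      target.\<close>
    define V where "V = W - io i ` ZT i"
    have VW: "V \<subseteq> W" "V \<subseteq> X'" by (auto simp: V_def W_def)
    have finV: "finite V" using VW X'Q Q_B fin_B by (meson finite_subset subset_trans)
    have sumyq: "dT i (\<Sum>a\<in>A. y a) = rho k (\<Sum>a\<in>A. q a)" "io i (\<Sum>a\<in>A. y a) = \<Sum>A" "(\<Sum>a\<in>A. y a) \<in> T i"
      if A: "A \<subseteq> W" for A
    proof -
      have "dT i (\<Sum>a\<in>A. y a) = (\<Sum>a\<in>A. dT i (y a))" using A y(1) by (intro additive_sum[OF T_f2 dT_add]) auto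
      also have "\<dots> = (\<Sum>a\<in>A. rho k (q a))" by (rule sum.cong) (use A y(3) in auto)
      also have "\<dots> = rho k (\<Sum>a\<in>A. q a)" using A qB by (intro additive_sum[OF B_f2 rho_add, symmetric]) auto
      finally show "dT i (\<Sum>a\<in>A. y a) = rho k (\<Sum>a\<in>A. q a)" .
      have "io i (\<Sum>a\<in>A. y a) = (\<Sum>a\<in>A. io i (y a))" using A y(1) by (intro additive_sum[OF T_f2 io_add]) auto
      also have "\<dots> = \<Sum>A" by (rule sum.cong) (use A y(2) in auto)
      finally show "io i (\<Sum>a\<in>A. y a) = \<Sum>A" .
      show "(\<Sum>a\<in>A. y a) \<in> T i" using A y(1) by (intro f2_sum[OF T_f2]) auto
    qed
    have V_indep: "A = {}" if A: "A \<subseteq> V" "(\<Sum>a\<in>A. q a) \<in> c1" for A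
    proof -
      have AW: "A \<subseteq> W" using A VW by auto
      obtain z where z: "z \<in> B i" "(\<Sum>a\<in>A. q a) = dB i z" using A by (auto simp: c1_def)
      let ?s = "\<Sum>a\<in>A. y a"
      have "dT i (?s + rho i z) = rho k (dB i z) + rho k (dB i z)"
        using additive_onD[OF dT_add sumyq(3)[OF AW] rho_in[OF z(1)]] sumyq(1)[OF AW] z(2) dT_rho'[OF z(1)] by simp
      also have "\<dots> = 0" by (rule f2_double[OF T_f2 rho_in[OF dB_in'[OF z(1)]]])
      finally have "?s + rho i z \<in> ZT i" using f2_add[OF T_f2 sumyq(3)[OF AW] rho_in[OF z(1)]] by (simp add: ZT_def)
      moreover have "io i (?s + rho i z) = \<Sum>A"
        using additive_onD[OF io_add sumyq(3)[OF AW] rho_in[OF z(1)]] sumyq(2)[OF AW] io_rho[OF z(1)] by simp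
      ultimately have "\<Sum>A \<in> io i ` ZT i" by (metis imageI)
      then have "\<Sum>A \<in> span2 (X' \<inter> io i ` ZT i)" using spL[of 0] L0 by simp
      then have "A \<subseteq> X' \<inter> io i ` ZT i"
        by (rule indep2_in_span[OF Q_f2 X'Q, rotated -1]) (use A VW finite_subset[OF A(1) finV] in auto)
      then show ?thesis using A by (auto simp: V_def)
    qed
    have q_inj: "inj_on q V"
    proof (rule inj_onI, rule ccontr)
      fix a b assume ab: "a \<in> V" "b \<in> V" "q a = q b" "a \<noteq> b"
      then have "(\<Sum>a\<in>{a, b}. q a) = q b + q b" by simp
      also have "\<dots> = 0" by (rule f2_double[OF B_f2 qB]) (use ab VW in auto)
      finally have "(\<Sum>a\<in>{a, b}. q a) \<in> c1" using f2_zero[OF c1_f2] by simp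
      then have "{a, b} = {}" by (rule V_indep[rotated]) (use ab in auto)
      then show False by simp
    qed
    have q_c1: "q a \<notin> c1" if "a \<in> V" for a
      using V_indep[of "{a}"] that by auto
    define Y2 where "Y2 = Y1 \<union> q ` V"
    have q_c2: "q a \<in> c2" if "a \<in> W" for a
      unfolding c2_def using y(4)[OF that] y(3)[OF that, symmetric] y(1)[OF that] by auto
    have Y2c2: "Y2 \<subseteq> c2" using Y1 c12 q_c2 VW by (auto simp: Y2_def basis2_def)
    have Y2B: "Y2 \<subseteq> B k" using Y2c2 Q_B by (auto simp: c2_def)
    have Y2_indep: "indep2 Y2"
      unfolding Y2_def
    proof (rule indep2_Un[OF c2_f2])
      show "Y1 \<subseteq> c2" "q ` V \<subseteq> c2" using Y2c2 by (auto simp: Y2_def)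
      show "indep2 Y1" using Y1 by (auto simp: basis2_def)
      fix D assume D: "finite D" "D \<subseteq> q ` V - Y1" "\<Sum>D \<in> span2 Y1"
      then obtain A where A: "A \<subseteq> V" "D = q ` A" by (metis Diff_subset subset_image_iff subset_trans)
      have "\<Sum>D = (\<Sum>a\<in>A. q a)" using A inj_on_subset[OF q_inj A(1)] by (simp add: sum.reindex)
      then have "A = {}" using D(3) Y1(2) A(1) V_indep[of A] by (simp add: basis2_def)
      then show "D = {}" using A by simp
    qed
    \<comment> \<open>If \<open>dT i t = rho k z\<close> with \<open>z\<close> in
      \<open>F j\<close>, then \<open>io i t\<close> is in step \<open>Suc j\<close> of the new flag
      and expands in elements of \<open>X'\<close> from that step, whose targets lie in
      \<open>F j\<close>. The lift \<open>t\<close> and the corresponding sum of lifts differ by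
      some \<open>rho i b\<close>, so \<open>z\<close> and the sum of targets differ by
      \<open>dB i b\<close>, an element of \<open>F j \<inter> c1\<close>, where \<open>Y1\<close>
      is already adapted.\<close>
    have Y2_flag: "F j \<inter> c2 \<subseteq> span2 (Y2 \<inter> F j)" if j: "j \<le> m" for j
    proof
      fix z assume z: "z \<in> F j \<inter> c2"
      then obtain t where t: "t \<in> T i" "dT i t = rho k z" by (auto simp: c2_def)
      then have "io i t \<in> io i ` L j" using z by (auto simp: L_def)
      then have "io i t \<in> span2 (X' \<inter> io i ` L j)" using spL[OF j] by simp
      then obtain A where A: "finite A" "A \<subseteq> X' \<inter> io i ` L j" "io i t = \<Sum>A" by (rule span2E)
      have "L j \<subseteq> L m" using Fm[OF j] by (auto simp: L_def)
      then have AW: "A \<subseteq> W" using A(2) unfolding W_def by blast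
      let ?s = "\<Sum>a\<in>A. y a" and ?q = "\<Sum>a\<in>A. q a"
      have "io i (t + ?s) = \<Sum>A + \<Sum>A" using additive_onD[OF io_add t(1) sumyq(3)[OF AW]] sumyq(2)[OF AW] A(3) by simp
      also have "\<dots> = 0" using f2_double[OF B_f2 io_in[OF sumyq(3)[OF AW]]] sumyq(2)[OF AW] by simp
      finally obtain b where b: "b \<in> B i" "t + ?s = rho i b"
        using io_ker f2_add[OF T_f2 t(1) sumyq(3)[OF AW]] by blast
      have qF: "q a \<in> F j" if "a \<in> A" for a by (rule y(5)[OF _ j]) (use that AW A(2) in auto)
      have qFs: "?q \<in> F j" using qF by (intro f2_sum[OF F(2)]) auto
      have "rho k (z + ?q) = dT i t + dT i ?s"
        using sumyq(1)[OF AW] t(2) additive_onD[OF rho_add, of z k ?q] z qFs FB[of j] by auto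
      also have "\<dots> = dT i (rho i b)" using additive_onD[OF dT_add t(1) sumyq(3)[OF AW]] b by simp
      also have "\<dots> = rho k (dB i b)" using b dT_rho' by simp
      finally have zq: "z + ?q = dB i b"
        using rho_inj[of "z + ?q" k "dB i b"] dB_in'[OF b(1)] f2_add[OF F(2), of z j ?q] z qFs FB[of j] by blast
      then have "z + ?q \<in> F j \<inter> c1" using f2_add[OF F(2), of z j ?q] z qFs b by (simp add: c1_def)
      then have "z + ?q \<in> span2 (Y1 \<inter> F j)" using Y1(3)[OF j] by simp
      moreover have "span2 (Y1 \<inter> F j) \<subseteq> span2 (Y2 \<inter> F j)" by (rule span2_mono) (auto simp: Y2_def)
      ultimately have zq2: "z + ?q \<in> span2 (Y2 \<inter> F j)" by blast
      have Y2j: "Y2 \<inter> F j \<subseteq> B k" using Y2B by auto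
      have "?q \<in> span2 (Y2 \<inter> F j)"
      proof (rule span2_sum[OF B_f2 Y2j])
        fix a assume a: "a \<in> A"
        show "q a \<in> span2 (Y2 \<inter> F j)"
        proof (cases "a \<in> V")
          case True
          then show ?thesis using qF[OF a] by (intro span2_base) (auto simp: Y2_def)
        next
          case False
          then have "a \<in> io i ` L 0" using a AW L0 by (auto simp: V_def)
          then have "q a \<in> F 0" using a AW by (intro y(5)) auto
          then show ?thesis using F(1) span2_zero by auto
        qed
      qed
      then have "?q + (?q + z) \<in> span2 (Y2 \<inter> F j)"
        using f2_add[OF span2_f2[OF B_f2 Y2j]] zq2 by (simp add: add.commute)
      then show "z \<in> span2 (Y2 \<inter> F j)" using f2_cancel[OF F(2) qFs] by simp
    qed
    obtain X where X: "Y2 \<subseteq> X" "basis2 X (Q k)" "\<And>j. j \<le> m \<Longrightarrow> span2 (X \<inter> F j) = F j"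
    proof -
      have "\<exists>X. Y2 \<subseteq> X \<and> basis2 X (F m) \<and> (\<forall>j\<le>m. span2 (X \<inter> F j) = F j)"
      proof (rule flag_extend[where F = F and Y = Y2 and m = m])
        show "f2_space (F j)" "F j \<subseteq> F (Suc j)" for j using F(2,3) .
        show "indep2 Y2" by (rule Y2_indep)
        show "finite (F j)" for j using F(4) by (rule finS)
        show "Y2 \<subseteq> F m" using Y2c2 F(5) by (auto simp: c2_def)
        show "F j \<inter> span2 Y2 \<subseteq> span2 (Y2 \<inter> F j)" if "j \<le> m" for j
          using Y2_flag[OF that] span2_sub[OF c2_f2 Y2c2] by blast
      qed
      then show ?thesis using that F(5) by auto
    qed
    have Y0c0: "Y0 \<subseteq> c0" using Y0(1) by (simp add: basis2_def)
    have "\<exists>t\<in>T i. io k (dT i t) = x" if "x \<in> Y0" for x using that Y0c0 by (auto simp: c0_def)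
    then obtain yy where yy: "\<And>x. x \<in> Y0 \<Longrightarrow> yy x \<in> T i" "\<And>x. x \<in> Y0 \<Longrightarrow> io k (dT i (yy x)) = x" by metis
    have "\<exists>b\<in>B i. dB i b = x" if "x \<in> Y1" for x using that Y1(2) by (auto simp: basis2_def c1_def)
    then obtain bb where bb: "\<And>x. x \<in> Y1 \<Longrightarrow> bb x \<in> B i" "\<And>x. x \<in> Y1 \<Longrightarrow> dB i (bb x) = x" by metis
    \<comment> \<open>A preimage under \<open>dB i\<close> for each element of \<open>Y1\<close>. On
      \<open>Y0\<close> it is taken in the image of \<open>io\<close>, so that it represents a
      generator of \<open>F\<close>; on the rest of \<open>Y1\<close> it becomes a generator of
      \<open>H\<close>.\<close>
    define g where "g x = (if x \<in> Y0 then io i (yy x) else bb x)" for x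
    have g: "g x \<in> B i \<and> dB i (g x) = x" if "x \<in> Y1" for x
      using that bb yy io_in dB_io' by (auto simp: g_def)
    \<comment> \<open>On \<open>Y0\<close> the lift requested in degree \<open>k\<close> is the very
      image of \<open>yy x\<close>, so that the differential between these two copies of
      \<open>F\<close> is the identity. Elsewhere any lift will do.\<close>
    define l where "l x = (if x \<in> Y0 then dT i (yy x) else SOME z. z \<in> ZT k \<and> io k z = x)" for x
    have l: "l x \<in> ZT k \<and> io k (l x) = x" if "x \<in> X" "x \<in> io k ` ZT k" for x
    proof (cases "x \<in> Y0")
      case True
      then show ?thesis using yy dT_in' dT_dT' by (auto simp: l_def ZT_def)
    next
      case False
      then show ?thesis using that(2) someI_ex[of "\<lambda>z. z \<in> ZT k \<and> io k z = x"] by (auto simp: l_def)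
    qed
    have "\<exists>E G. (\<forall>k'\<le>k. gens k' (E k') (G k') \<and> linked k' (E k') (G k') (E (k' - 1)) (G (k' - 1))) \<and>
               X \<subseteq> io k ` E k \<union> G k \<and> l ` (X \<inter> io k ` ZT k) \<subseteq> E k"
      by (rule IH[rule_format]) (use X(2,3) l in auto)
    then obtain E G where EG: "\<And>k'. k' \<le> k \<Longrightarrow> gens k' (E k') (G k')"
      "\<And>k'. k' \<le> k \<Longrightarrow> linked k' (E k') (G k') (E (k' - 1)) (G (k' - 1))"
      "X \<subseteq> io k ` E k \<union> G k" "l ` (X \<inter> io k ` ZT k) \<subseteq> E k"
      by (elim exE conjE) blast
    have Y01X: "Y0 \<subseteq> X" "Y1 \<subseteq> X" using X(1) Y1(1) by (auto simp: Y2_def)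
    have lE: "dT i (yy x) \<in> E k" if "x \<in> Y0" for x
    proof -
      have "dT i (yy x) \<in> ZT k" using yy(1)[OF that] dT_in' dT_dT' by (simp add: ZT_def)
      then have "x \<in> io k ` ZT k" using yy(2)[OF that] by (metis imageI)
      then have "l x \<in> E k" using EG(4) that Y01X(1) by blast
      then show ?thesis using that by (simp add: l_def)
    qed
    \<comment> \<open>Generators of \<open>F\<close> sent down by \<open>u\<close>, \<open>p\<close>
      or zero come from \<open>W\<close>, those sent down by the identity from \<open>Y0\<close>.
      Generators of \<open>H\<close> with zero differential come from \<open>X' - W\<close>, those
      with nonzero differential from \<open>Y1 - Y0\<close>.\<close>
    define E' where "E' = y ` W \<union> yy ` Y0"
    define G' where "G' = (X' - W) \<union> g ` (Y1 - Y0)"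
    have ioE': "io i ` E' = W \<union> g ` Y0" using y(2) by (force simp: E'_def g_def image_Un image_image)
    have WX: "W \<subseteq> X'" by (auto simp: W_def)
    have union: "io i ` E' \<union> G' = X' \<union> g ` Y1" using WX Y1(1) unfolding ioE' G'_def by auto
    have Y1nz: "x \<noteq> 0" if "x \<in> Y1" for x using that indep2_nonzero Y1(2) by (auto simp: basis2_def)
    have g_inj: "a = b" if "a \<in> Y1" "b \<in> Y1" "g a = g b" for a b using that g by metis
    have gX': "g x \<notin> X'" if "x \<in> Y1" for x using X'Q(1) g[OF that] Y1nz[OF that] by (auto simp: Q_def)
    have Xnz: "0 \<notin> io k ` E k \<union> G k" using EG(1)[of k] indep2_nonzero by (auto simp: gens_def basis2_def)
    have gens': "gens i E' G'"
      unfolding gens_def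
    proof (intro conjI)
      show E'T: "E' \<subseteq> T i" using y(1) yy(1) by (auto simp: E'_def)
      show "inj_on (io i) E'"
      proof (rule inj_onI)
        fix a b assume ab: "a \<in> E'" "b \<in> E'" "io i a = io i b"
        have E'_iff: "(\<exists>x\<in>W. e = y x \<and> io i e = x) \<or> (\<exists>x\<in>Y0. e = yy x \<and> io i e = g x)" if "e \<in> E'" for e
          using that y(2) by (auto simp: E'_def g_def)
        have "g x \<noteq> w" if "x \<in> Y0" "w \<in> W" for x w using that gX'[of x] WX Y1(1) by blast
        moreover have "x = x'" if "x \<in> Y0" "x' \<in> Y0" "g x = g x'" for x x' using that g_inj Y1(1) by blast
        ultimately show "a = b" using E'_iff[OF ab(1)] E'_iff[OF ab(2)] ab(3) by metis
      qed
      show "io i ` E' \<inter> G' = {}" using gX' g_inj WX Y1(1) unfolding ioE' G'_def by blast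
      show "basis2 (io i ` E' \<union> G') (B i)"
        unfolding union
      proof (rule basis2_kernel_image[OF B_f2 dB_add B_f2[of k]])
        show "dB i ` B i \<subseteq> B k" using dB_in' by auto
        show "basis2 X' {x \<in> B i. dB i x = 0}" using X'(1) by (simp add: Q_def)
        show "basis2 Y1 (dB i ` B i)" using Y1(2) by (simp add: c1_def)
      qed (rule g)
      have sub: "io i ` E' \<subseteq> B i" using E'T io_in by auto
      show "span2 (io i ` E') = io i ` T i"
      proof
        show "span2 (io i ` E') \<subseteq> io i ` T i"
        proof (rule span2_sub)
          show "f2_space (io i ` T i)" by (rule f2_image[OF T_f2 io_add _ B_f2[of i]]) (use io_in in auto)
        qed (use E'T in auto)
        \<comment> \<open>A combination of the \<open>yy a\<close> is added to \<open>t\<close> to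
          make \<open>io k (dT i t)\<close> vanish. Then the differential of the sum is
          \<open>rho k b\<close>, where \<open>b\<close> is a cycle because \<open>rho\<close> is
          injective. As \<open>F m\<close> is all of \<open>Q k\<close>, the sum lies in
          \<open>L m\<close>, whose image \<open>W\<close> spans.\<close>
        show "io i ` T i \<subseteq> span2 (io i ` E')"
        proof
          fix z assume "z \<in> io i ` T i"
          then obtain t where t: "t \<in> T i" "z = io i t" by auto
          then have "io k (dT i t) \<in> span2 Y0" using Y0(1) by (auto simp: basis2_def c0_def)
          then obtain A where A: "finite A" "A \<subseteq> Y0" "io k (dT i t) = \<Sum>A" by (rule span2E)
          let ?s = "\<Sum>a\<in>A. yy a"
          have sT: "?s \<in> T i" using A yy by (intro f2_sum[OF T_f2]) auto
          have ds: "dT i ?s = (\<Sum>a\<in>A. dT i (yy a))" using A yy by (intro additive_sum[OF T_f2 dT_add]) auto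
          have "io k (dT i ?s) = (\<Sum>a\<in>A. io k (dT i (yy a)))"
            unfolding ds using A yy dT_in' by (intro additive_sum[OF T_f2 io_add]) auto
          also have "\<dots> = \<Sum>A" using A yy by (intro sum.cong) auto
          finally have "io k (dT i (t + ?s)) = \<Sum>A + \<Sum>A"
            using A(3) additive_onD[OF dT_add t(1) sT] additive_onD[OF io_add dT_in'[OF t(1)] dT_in'[OF sT]] by simp
          also have "\<dots> = 0" using f2_double[OF B_f2 io_in[OF dT_in'[OF t(1)]]] A(3) by simp
          finally obtain b where b: "b \<in> B k" "dT i (t + ?s) = rho k b"
            using io_ker dT_in' f2_add[OF T_f2 t(1) sT] by blast
          have "rho (k - 1) (dB k b) = 0"
            using b dT_dT'[OF f2_add[OF T_f2 t(1) sT]] dT_rho[OF b(1)] by simp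
          then have "dB k b = 0" using rho_inj[OF dB_in[OF b(1)] f2_zero[OF B_f2]] rho_0 by simp
          then have "b \<in> Q k" using b by (simp add: Q_def)
          then have "t + ?s \<in> L m" using b f2_add[OF T_f2 t(1) sT] F(5) by (auto simp: L_def)
          then have "io i (t + ?s) \<in> span2 (X' \<inter> io i ` L m)" using spL[of m] by simp
          then have "io i (t + ?s) \<in> span2 (io i ` E')"
            using span2_mono[of W "io i ` E'"] ioE' by (auto simp: W_def)
          moreover have "io i ?s \<in> span2 (io i ` E')"
          proof -
            have "io i ?s = (\<Sum>a\<in>A. io i (yy a))" using A yy by (intro additive_sum[OF T_f2 io_add]) auto
            moreover have "\<dots> \<in> span2 (io i ` E')"
              using A by (intro span2_sum[OF B_f2 sub] span2_base) (auto simp: E'_def)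
            ultimately show ?thesis by simp
          qed
          moreover have "io i (t + ?s) = io i t + io i ?s" using additive_onD[OF io_add t(1) sT] .
          ultimately have "io i ?s + (io i ?s + io i t) \<in> span2 (io i ` E')"
            using f2_add[OF span2_f2[OF B_f2 sub]] by (simp add: add.commute)
          then show "z \<in> span2 (io i ` E')" using t f2_cancel[OF B_f2 io_in[OF sT]] by simp
        qed
      qed
    qed
    have qX: "q x \<in> X" if "x \<in> V" for x using that X(1) by (auto simp: Y2_def)
    have q0: "q x = 0" if "x \<in> W" "x \<notin> V" for x
    proof -
      have "x \<in> io i ` L 0" using that L0 by (auto simp: V_def)
      then show ?thesis using y(5)[OF that(1), of 0] F(1) by auto
    qed
    \<comment> \<open>Targets in \<open>Y1\<close> are hit by their preimage under \<open>g\<close>,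
      all others through \<open>q\<close>. The two kinds cannot meet, since \<open>q\<close> avoids
      \<open>c1\<close>; together with injectivity of \<open>q\<close> on \<open>V\<close> this
      excludes double hits.\<close>
    have tgt': "x \<in> Y1 \<and> x' = g x \<or> x \<notin> Y1 \<and> x' \<in> V \<and> q x' = x"
      if t: "tgt i E' G' (E k) x' x" and x: "x \<in> io k ` E k \<union> G k" for x' x
    proof -
      have xB: "x \<in> B k" using x EG(1)[of k] by (auto simp: gens_def basis2_def)
      have x0: "x \<noteq> 0" using x Xnz by metis
      from t consider (e) e where "e \<in> E'" "x' = io i e" "x = io k (dT i e) \<or> dT i e = rho k x"
        | (g) "x' \<in> G'" "x = dB i x'" unfolding tgt_def k_def[symmetric] by blast
      then show ?thesis
      proof cases
        case e
        show ?thesis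
        proof (cases "e \<in> y ` W")
          case True
          then obtain w where w: "w \<in> W" "e = y w" by auto
          have "x \<noteq> io k (dT i e)" using w y(3) io_rho[OF qB[OF w(1)]] x0 by metis
          then have "rho k (q w) = rho k x" using e(3) w y(3) by auto
          then have "q w = x" using rho_inj qB[OF w(1)] xB by metis
          moreover from this have "w \<in> V" using q0 w x0 by metis
          moreover have "x' = w" using e w y(2) by auto
          moreover have "x \<notin> Y1" using q_c1[OF \<open>w \<in> V\<close>] \<open>q w = x\<close> Y1(2) by (auto simp: basis2_def)
          ultimately show ?thesis by auto
        next
          case False
          then obtain w where w: "w \<in> Y0" "e = yy w" using e by (auto simp: E'_def)
          have "dT i e \<noteq> rho k x" using w yy(2) io_rho[OF xB] Y1nz Y1(1) by (metis subsetD)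
          then have "x = w" using e(3) w yy(2) by auto
          then show ?thesis using w e Y1(1) by (auto simp: g_def)
        qed
      next
        case g
        show ?thesis
        proof (cases "x' \<in> X'")
          case True
          then have "x = 0" using X'Q g by (auto simp: Q_def)
          then show ?thesis using x0 by simp
        next
          case False
          then obtain w where "w \<in> Y1" "x' = g w" using \<open>x' \<in> G'\<close> by (auto simp: G'_def)
          then show ?thesis using \<open>x = dB i x'\<close> \<open>\<And>x. x \<in> Y1 \<Longrightarrow> g x \<in> B i \<and> dB i (g x) = x\<close> by auto
        qed
      qed
    qed
    have linked': "linked i E' G' (E k) (G k)"
      unfolding linked_def k_def[symmetric]
    proof (intro conjI ballI allI impI)
      fix e assume "e \<in> E'"
      then consider w where "w \<in> W" "e = y w" | w where "w \<in> Y0" "e = yy w" by (auto simp: E'_def)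
      then show "dT i e = 0 \<or> dT i e \<in> E k \<or> (\<exists>x\<in>io k ` E k \<union> G k. dT i e = rho k x)"
      proof cases
        case 1
        then show ?thesis using y(3) q0 qX EG(3) rho_0 by (cases "w \<in> V") (metis subsetD, metis)
      next
        case 2
        then show ?thesis using lE by auto
      qed
    next
      fix e assume "e \<in> G'"
      then consider "e \<in> X'" | w where "w \<in> Y1" "e = g w" by (auto simp: G'_def)
      then show "dB i e = 0 \<or> dB i e \<in> io k ` E k \<union> G k"
      proof cases
        case 1
        then show ?thesis using X'Q by (auto simp: Q_def)
      next
        case 2
        then show ?thesis using g Y01X EG(3) by auto
      qed
    next
      fix x a b assume x: "x \<in> io k ` E k \<union> G k" "tgt i E' G' (E k) a x" "tgt i E' G' (E k) b x"
      show "a = b" using tgt'[OF x(2,1)] tgt'[OF x(3,1)] q_inj by (metis inj_onD)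
    qed
    show "\<exists>E G. (\<forall>k\<le>i. gens k (E k) (G k) \<and> linked k (E k) (G k) (E (k - 1)) (G (k - 1))) \<and>
              X' \<subseteq> io i ` E i \<union> G i \<and> l' ` (X' \<inter> io i ` ZT i) \<subseteq> E i"
    proof (intro exI[of _ "E(i := E')"] exI[of _ "G(i := G')"] conjI allI impI)
      fix k' assume "k' \<le> i"
      then consider "k' = i" | "k' \<le> k" "k' \<noteq> i" "k' - 1 \<noteq> i" by (fastforce simp: k_def)
      then show "gens k' ((E(i := E')) k') ((G(i := G')) k')"
        "linked k' ((E(i := E')) k') ((G(i := G')) k') ((E(i := E')) (k' - 1)) ((G(i := G')) (k' - 1))"
        using gens' linked' EG(1,2) by (cases; simp add: k_def)+
    next
      show "X' \<subseteq> io i ` (E(i := E')) i \<union> (G(i := G')) i" using union by auto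
      have "l' x \<in> E'" if "x \<in> X'" "x \<in> io i ` ZT i" for x
      proof -
        have "L 0 \<subseteq> L m" using Fm[of 0 m] by (auto simp: L_def)
        then have "x \<in> io i ` L m" using that(2) L0 by blast
        then have "x \<in> W" using that by (simp add: W_def)
        then show ?thesis using y(6) that by (force simp: E'_def)
      qed
      then show "l' ` (X' \<inter> io i ` ZT i) \<subseteq> (E(i := E')) i" by auto
    qed
  qed
qed

section \<open>From the inductive step to compatible generators in all degrees\<close>

lemma gens_trivial:
  assumes "T k = {0}" "B k = {0}"
  shows "gens k E G \<longleftrightarrow> E = {} \<and> G = {}"
proof
  assume "gens k E G"
  then have sub: "E \<subseteq> {0}" "G \<subseteq> {0}" and "indep2 (io k ` E \<union> G)"
    using assms by (auto simp: gens_def basis2_def)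
  then have "0 \<notin> io k ` E" "0 \<notin> G" using indep2_nonzero by blast+
  moreover from this have "0 \<notin> E" using io_0[of k] by (metis imageI)
  ultimately show "E = {} \<and> G = {}" using sub by blast
next
  assume "E = {} \<and> G = {}"
  then show "gens k E G"
    using assms io_0[of k] by (auto simp: gens_def basis2_def indep2_empty span2_empty)
qed

lemma flagged_base:
  assumes "\<And>k. k \<le> i \<Longrightarrow> T k = {0} \<and> B k = {0}"
  shows "flagged i"
proof -
  have Q0: "Q i = {0}" using assms[of i] dB_0 by (auto simp: Q_def)
  have gens0: "gens k {} {}" if "k \<le> i" for k
    using gens_trivial[of k "{}" "{}"] assms[OF that] by blast
  have linked0: "linked k {} {} {} {}" for k by (auto simp: linked_def)
  show ?thesis
    unfolding flagged_def
  proof (rule exI[of _ "\<lambda>_. {0}"], rule exI[of _ 0], intro conjI allI impI)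
    fix X l assume "basis2 X (Q i)"
    then have X: "X = {}" using Q0 indep2_nonzero by (auto simp: basis2_def)
    show "\<exists>E G. (\<forall>k\<le>i. gens k (E k) (G k) \<and> linked k (E k) (G k) (E (k - 1)) (G (k - 1))) \<and>
              X \<subseteq> io i ` E i \<union> G i \<and> l ` (X \<inter> io i ` ZT i) \<subseteq> E i"
      using gens0 linked0 X by (intro exI[of _ "\<lambda>_. {}"] conjI) auto
  qed (auto simp: Q0 f2_singleton)
qed

text \<open>\<open>flagged\<close> only speaks about a given adapted basis with given lifts; here
  both are supplied, the basis by extending the empty set along the flag.\<close>

lemma flagged_family:
  assumes "flagged i"
  shows "\<exists>E G. \<forall>k\<le>i. gens k (E k) (G k) \<and> linked k (E k) (G k) (E (k - 1)) (G (k - 1))"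
proof -
  obtain F m where F: "\<And>j. f2_space (F j)" "\<And>j. F j \<subseteq> F (Suc j)" "\<And>j. F j \<subseteq> Q i" "F m = Q i"
    and *: "\<forall>X l. basis2 X (Q i) \<longrightarrow> (\<forall>j\<le>m. span2 (X \<inter> F j) = F j) \<longrightarrow>
        (\<forall>x\<in>X \<inter> io i ` ZT i. l x \<in> ZT i \<and> io i (l x) = x) \<longrightarrow>
        (\<exists>E G. (\<forall>k\<le>i. gens k (E k) (G k) \<and> linked k (E k) (G k) (E (k - 1)) (G (k - 1))) \<and>
               X \<subseteq> io i ` E i \<union> G i \<and> l ` (X \<inter> io i ` ZT i) \<subseteq> E i)"
    using assms unfolding flagged_def by (elim exE conjE) blast
  have "finite (F j)" for j using F(3)[of j] Q_B fin_B by (meson finite_subset)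
  then have "\<exists>X. {} \<subseteq> X \<and> basis2 X (F m) \<and> (\<forall>j\<le>m. span2 (X \<inter> F j) = F j)"
    by (intro flag_extend[where F = F] F(1,2)) (auto simp: indep2_empty span2_empty span2_zero)
  then obtain X where X: "basis2 X (Q i)" "\<forall>j\<le>m. span2 (X \<inter> F j) = F j" using F(4) by auto
  have "\<forall>x\<in>io i ` ZT i. \<exists>z. z \<in> ZT i \<and> io i z = x" by auto
  then obtain l where "\<forall>x\<in>io i ` ZT i. l x \<in> ZT i \<and> io i (l x) = x" by metis
  then show ?thesis using *[rule_format, of X l] X by blast
qed

lemma linked_family:
  assumes N: "\<And>k. k < N \<Longrightarrow> T k = {0} \<and> B k = {0}"
  shows "\<exists>E G. \<forall>k. gens k (E k) (G k) \<and> linked k (E k) (G k) (E (k - 1)) (G (k - 1))"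
proof -
  have fl: "flagged (N - 1 + int n)" for n
  proof (induction n)
    case 0
    show ?case using N by (intro flagged_base) auto
  next
    case (Suc n)
    moreover have "N - 1 + int (Suc n) - 1 = N - 1 + int n" by simp
    ultimately show ?case using flagged_step[of "N - 1 + int (Suc n)"] by metis
  qed
  have gens0: "gens k E G \<longleftrightarrow> E = {} \<and> G = {}" if "k < N" for k E G
    by (rule gens_trivial) (use N[OF that] in auto)
  \<comment> \<open>Level 0 is degree \<open>N - 1\<close>, where the complex is still zero and the
    only choice is the empty one; \<open>R n\<close> therefore links degree \<open>N + n\<close> to
    the degree below it. Levels are finite because they consist of pairs of subsets of finite
    carriers.\<close>
  define A where "A n = {(E, G). gens (N - 1 + int n) E G}" for n
  define R where "R n p p' \<longleftrightarrow> linked (N + int n) (fst p') (snd p') (fst p) (snd p)"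
    for n :: nat and p p' :: "'a set \<times> 'b set"
  have "\<exists>p. \<forall>k. p k \<in> A k \<and> R k (p k) (p (Suc k))"
  proof (rule koenig)
    fix n
    have "A n \<subseteq> Pow (T (N - 1 + int n)) \<times> Pow (B (N - 1 + int n))"
      by (auto simp: A_def gens_def basis2_def)
    then show "finite (A n)" using fin_T fin_B by (meson finite_Pow_iff finite_SigmaI finite_subset)
    obtain E G where EG: "\<forall>k\<le>N - 1 + int n. gens k (E k) (G k) \<and> linked k (E k) (G k) (E (k - 1)) (G (k - 1))"
      using flagged_family[OF fl] by blast
    define p where "p k = (E (N - 1 + int k), G (N - 1 + int k))" for k
    have "p k \<in> A k" if "k \<le> n" for k using EG that by (auto simp: p_def A_def)
    moreover have "R k (p k) (p (Suc k))" if "k < n" for k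
      using EG[rule_format, of "N + int k"] that by (auto simp: p_def R_def algebra_simps)
    ultimately show "\<exists>p. (\<forall>k\<le>n. p k \<in> A k) \<and> (\<forall>k<n. R k (p k) (p (Suc k)))" by blast
  qed
  then obtain p where p: "\<And>k. p k \<in> A k" "\<And>k. R k (p k) (p (Suc k))" by blast
  define E where "E k = (if k < N then {} else fst (p (nat (k - (N - 1)))))" for k
  define G where "G k = (if k < N then {} else snd (p (nat (k - (N - 1)))))" for k
  have gens: "gens k (E k) (G k)" for k
    using p(1)[of "nat (k - (N - 1))"] gens0[of k] by (auto simp: A_def E_def G_def)
  moreover have "linked k (E k) (G k) (E (k - 1)) (G (k - 1))" for k
  proof (cases "k < N")
    case True
    then show ?thesis by (auto simp: linked_def E_def G_def)
  next
    case False
    define n where "n = nat (k - N)"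
    have n: "k = N + int n" using False by (simp add: n_def)
    have "fst (p n) = E (k - 1) \<and> snd (p n) = G (k - 1)"
    proof (cases "n = 0")
      case True
      then have "gens (N - 1) (fst (p n)) (snd (p n))" using p(1)[of 0] by (auto simp: A_def)
      then show ?thesis using gens0[of "N - 1"] True n by (auto simp: E_def G_def)
    next
      case False
      then show ?thesis using n by (auto simp: E_def G_def)
    qed
    moreover have "fst (p (Suc n)) = E k \<and> snd (p (Suc n)) = G k"
    proof -
      have "nat (k - (N - 1)) = Suc n" using n by simp
      then show ?thesis using False by (simp add: E_def G_def)
    qed
    ultimately show ?thesis using p(2)[of n] n by (simp add: R_def)
  qed
  ultimately show ?thesis by blast
qed

end

section \<open>Finite sums of copies of F and H\<close>

text \<open>Besides \<open>FH_sum\<close>, this covers one degree of a sum of strands, where copies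
  of \<open>F\<close> and \<open>H\<close> occur in arbitrary order with gaps.\<close>

definition FH_family :: "(nat \<Rightarrow> (bit \<times> bit, bit) zmod) \<Rightarrow> bool" where
  "FH_family m \<longleftrightarrow> (\<forall>j. m j \<in> {zF, zH, zZ}) \<and> finite {j. m j \<noteq> zZ}"

lemma bit_add_self: "(x::bit) + x = 0"
  by (cases x) auto

lemma zmod_simps [simp]:
  "Top zF = UNIV" "Bot zF = UNIV" "tr zF = (\<lambda>(x, y). (y, x))" "res zF = (\<lambda>z. (z, z))" "ind zF = (\<lambda>(x, y). x + y)"
  "Top zH = {(x, 0) | x. True}" "Bot zH = UNIV" "tr zH = id" "res zH = (\<lambda>z. (z, 0))" "ind zH = (\<lambda>_. 0)"
  "Top zZ = {0}" "Bot zZ = {0}" "tr zZ = id" "res zZ = (\<lambda>_. 0)" "ind zZ = (\<lambda>_. 0)"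
  by (simp_all add: zF_def zH_def zZ_def)

lemma dsum_simps [simp]:
  "tr (dsum M) = (\<lambda>v j. tr (M j) (v j))" "res (dsum M) = (\<lambda>w j. res (M j) (w j))"
  "ind (dsum M) = (\<lambda>v j. ind (M j) (v j))"
  by (simp_all add: dsum_def)

lemma FH_Top: "FH_family m \<Longrightarrow> v \<in> Top (dsum m) \<longleftrightarrow> (\<forall>j. v j \<in> Top (m j))"
proof -
  assume m: "FH_family m"
  have "finite {j. v j \<noteq> 0}" if "\<forall>j. v j \<in> Top (m j)"
  proof (rule finite_subset)
    have "v j = 0" if "m j = zZ" for j
      using \<open>\<forall>j. v j \<in> Top (m j)\<close>[rule_format, of j] that by simp
    then show "{j. v j \<noteq> 0} \<subseteq> {j. m j \<noteq> zZ}" by blast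
  qed (use m in \<open>auto simp: FH_family_def\<close>)
  then show ?thesis by (auto simp: dsum_def)
qed

lemma FH_Bot: "FH_family m \<Longrightarrow> w \<in> Bot (dsum m) \<longleftrightarrow> (\<forall>j. w j \<in> Bot (m j))"
proof -
  assume m: "FH_family m"
  have "finite {j. w j \<noteq> 0}" if "\<forall>j. w j \<in> Bot (m j)"
  proof (rule finite_subset)
    have "w j = 0" if "m j = zZ" for j
      using \<open>\<forall>j. w j \<in> Bot (m j)\<close>[rule_format, of j] that by simp
    then show "{j. w j \<noteq> 0} \<subseteq> {j. m j \<noteq> zZ}" by blast
  qed (use m in \<open>auto simp: FH_family_def\<close>)
  then show ?thesis by (auto simp: dsum_def)
qed

lemma FH_closed1:
  assumes "M \<in> {zF, zH, zZ}"
  shows "x \<in> Top M \<Longrightarrow> y \<in> Top M \<Longrightarrow> x + y \<in> Top M"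
    and "z \<in> Bot M \<Longrightarrow> w \<in> Bot M \<Longrightarrow> z + w \<in> Bot M"
    and "x \<in> Top M \<Longrightarrow> tr M x \<in> Top M"
    and "z \<in> Bot M \<Longrightarrow> res M z \<in> Top M"
    and "x \<in> Top M \<Longrightarrow> ind M x \<in> Bot M"
  using assms by (elim insertE emptyE; simp; auto)+

lemma FH_closed:
  assumes m: "FH_family m"
  shows "v \<in> Top (dsum m) \<Longrightarrow> v' \<in> Top (dsum m) \<Longrightarrow> v + v' \<in> Top (dsum m)"
    and "w \<in> Bot (dsum m) \<Longrightarrow> w' \<in> Bot (dsum m) \<Longrightarrow> w + w' \<in> Bot (dsum m)"
    and "v \<in> Top (dsum m) \<Longrightarrow> tr (dsum m) v \<in> Top (dsum m)"
    and "w \<in> Bot (dsum m) \<Longrightarrow> res (dsum m) w \<in> Top (dsum m)"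
    and "v \<in> Top (dsum m) \<Longrightarrow> ind (dsum m) v \<in> Bot (dsum m)"
proof -
  have m': "m j \<in> {zF, zH, zZ}" for j using m unfolding FH_family_def by blast
  note cl = FH_closed1[OF m']
  show "v + v' \<in> Top (dsum m)" if "v \<in> Top (dsum m)" "v' \<in> Top (dsum m)"
    using that cl(1) unfolding FH_Top[OF m] by simp
  show "w + w' \<in> Bot (dsum m)" if "w \<in> Bot (dsum m)" "w' \<in> Bot (dsum m)"
    using that cl(2) unfolding FH_Bot[OF m] by simp
  show "tr (dsum m) v \<in> Top (dsum m)" if "v \<in> Top (dsum m)"
    using that cl(3) unfolding FH_Top[OF m] by simp
  show "res (dsum m) w \<in> Top (dsum m)" if "w \<in> Bot (dsum m)"
    using that cl(4) unfolding FH_Top[OF m] FH_Bot[OF m] by simp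
  show "ind (dsum m) v \<in> Bot (dsum m)" if "v \<in> Top (dsum m)"
    using that cl(5) unfolding FH_Top[OF m] FH_Bot[OF m] by simp
qed

lemma FH_res_inj1:
  "M \<in> {zF, zH, zZ} \<Longrightarrow> z \<in> Bot M \<Longrightarrow> w \<in> Bot M \<Longrightarrow> res M z = res M w \<Longrightarrow> z = w"
  by (elim insertE emptyE; simp)

lemma FH_ind_ker1:
  "M \<in> {zF, zH, zZ} \<Longrightarrow> x \<in> Top M \<Longrightarrow> ind M x = 0 \<Longrightarrow> fst x \<in> Bot M \<and> x = res M (fst x)"
proof (cases x)
  fix a b assume *: "M \<in> {zF, zH, zZ}" "x \<in> Top M" "ind M x = 0" "x = (a, b)"
  have "a = b" if "a + b = 0" using that by (cases a; cases b) auto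
  then show ?thesis using * by (elim insertE emptyE; simp add: zero_prod_def)
qed

lemma FH_res_inj:
  assumes m: "FH_family m" and w: "w \<in> Bot (dsum m)" "w' \<in> Bot (dsum m)" "res (dsum m) w = res (dsum m) w'"
  shows "w = w'"
proof
  fix j
  have "m j \<in> {zF, zH, zZ}" using m unfolding FH_family_def by blast
  moreover have "w j \<in> Bot (m j)" "w' j \<in> Bot (m j)" using w unfolding FH_Bot[OF m] by auto
  moreover have "res (m j) (w j) = res (m j) (w' j)" using fun_cong[OF w(3), of j] by simp
  ultimately show "w j = w' j" by (rule FH_res_inj1)
qed

lemma FH_ind_ker:
  assumes m: "FH_family m" and v: "v \<in> Top (dsum m)" "ind (dsum m) v = 0"
  shows "\<exists>w\<in>Bot (dsum m). v = res (dsum m) w"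
proof
  have *: "fst (v j) \<in> Bot (m j) \<and> v j = res (m j) (fst (v j))" for j
  proof (rule FH_ind_ker1)
    show "m j \<in> {zF, zH, zZ}" using m unfolding FH_family_def by blast
    show "v j \<in> Top (m j)" using v unfolding FH_Top[OF m] by auto
    show "ind (m j) (v j) = 0" using fun_cong[OF v(2), of j] by simp
  qed
  show "(\<lambda>j. fst (v j)) \<in> Bot (dsum m)" using * unfolding FH_Bot[OF m] by blast
  show "v = res (dsum m) (\<lambda>j. fst (v j))" using * by (simp add: fun_eq_iff)
qed

lemma FH_sum_family: "FH_family (\<lambda>j. if j < a then zF else if j < a + b then zH else zZ)"
proof -
  have "{j. (if j < a then zF else if j < a + b then zH else zZ) \<noteq> zZ} \<subseteq> {..<a + b}" by auto
  then show ?thesis unfolding FH_family_def by (auto intro: finite_subset)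
qed

lemma fin_FH_nice:
  assumes "is_zmod M" "fin_FH M"
  shows "nice M"
proof -
  obtain a b f where f: "ziso M (FH_sum a b) f" using assms(2) by (auto simp: fin_FH_def)
  define m where "m = (\<lambda>j. if j < a then zF else if j < a + b then zH else zZ)"
  have m: "FH_family m" unfolding m_def by (rule FH_sum_family)
  have D: "FH_sum a b = dsum m" by (simp add: FH_sum_def m_def)
  have h: "zhom M (dsum m) f" and bT: "bij_betw (fst f) (Top M) (Top (dsum m))"
    and bB: "bij_betw (snd f) (Bot M) (Bot (dsum m))" using f by (auto simp: ziso_def D)
  have T0: "Top (dsum m) \<subseteq> {v. \<forall>x. (x \<in> {..<a + b} \<longrightarrow> v x \<in> UNIV) \<and> (x \<notin> {..<a + b} \<longrightarrow> v x = 0)}"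
  proof
    fix v assume "v \<in> Top (dsum m)"
    then have v: "v j \<in> Top (m j)" for j using FH_Top[OF m] by blast
    have "v j = 0" if "\<not> j < a + b" for j using v[of j] that by (simp add: m_def)
    then show "v \<in> {v. \<forall>x. (x \<in> {..<a + b} \<longrightarrow> v x \<in> UNIV) \<and> (x \<notin> {..<a + b} \<longrightarrow> v x = 0)}" by auto
  qed
  have B0: "Bot (dsum m) \<subseteq> {v. \<forall>x. (x \<in> {..<a + b} \<longrightarrow> v x \<in> UNIV) \<and> (x \<notin> {..<a + b} \<longrightarrow> v x = 0)}"
  proof
    fix v assume "v \<in> Bot (dsum m)"
    then have v: "v j \<in> Bot (m j)" for j using FH_Bot[OF m] by blast
    have "v j = 0" if "\<not> j < a + b" for j using v[of j] that by (simp add: m_def)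
    then show "v \<in> {v. \<forall>x. (x \<in> {..<a + b} \<longrightarrow> v x \<in> UNIV) \<and> (x \<notin> {..<a + b} \<longrightarrow> v x = 0)}" by auto
  qed
  have "x \<in> {0, 1}" for x :: bit by (cases x) auto
  then have "(UNIV :: bit set) \<subseteq> {0, 1}" by blast
  then have finbit: "finite (UNIV :: bit set)" by (rule finite_subset) simp
  have "finite (Top (dsum m))"
    by (rule finite_subset[OF T0 finite_set_of_finite_funs[OF finite_lessThan finite_Prod_UNIV[OF finbit finbit]]])
  moreover have "finite (Bot (dsum m))"
    by (rule finite_subset[OF B0 finite_set_of_finite_funs[OF finite_lessThan finbit]])
  ultimately have fin: "finite (Top M)" "finite (Bot M)" using bij_betw_finite[OF bT] bij_betw_finite[OF bB] by auto
  have zr: "fst f (res M z) = res (dsum m) (snd f z)" if "z \<in> Bot M" for z using h that by (auto simp: zhom_def)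
  have zi: "snd f (ind M x) = ind (dsum m) (fst f x)" if "x \<in> Top M" for x using h that by (auto simp: zhom_def)
  have "z = w" if "z \<in> Bot M" "w \<in> Bot M" "res M z = res M w" for z w
  proof -
    have "snd f z = snd f w"
      by (rule FH_res_inj[OF m]) (use that zr[of z] zr[of w] bij_betwE[OF bB] in auto)
    then show ?thesis using inj_onD[OF bij_betw_imp_inj_on[OF bB]] that by blast
  qed
  moreover have "x \<in> res M ` Bot M" if x: "x \<in> Top M" "ind M x = 0" for x
  proof -
    have "snd f 0 = 0"
      using additive_zero[of "Bot M" "snd f"] assms(1) h by (auto simp: is_zmod_def zhom_def)
    then have "ind (dsum m) (fst f x) = 0" using zi[OF x(1)] x(2) by simp
    then obtain w where w: "w \<in> Bot (dsum m)" "fst f x = res (dsum m) w"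
      using FH_ind_ker[OF m] bij_betwE[OF bT] x(1) by blast
    then obtain z where z: "z \<in> Bot M" "w = snd f z" using bij_betw_imp_surj_on[OF bB] by blast
    then have "fst f x = fst f (res M z)" using w zr by simp
    moreover have "res M z \<in> Top M" using assms(1) z by (auto simp: is_zmod_def)
    ultimately have "x = res M z" using inj_onD[OF bij_betw_imp_inj_on[OF bT]] x(1) by blast
    then show ?thesis using z by simp
  qed
  ultimately show ?thesis using fin unfolding nice_def inj_on_def by blast
qed

lemma additive_inv_into:
  assumes bij: "bij_betw f S T" and add: "additive_on S f" and cl: "\<And>x y. x \<in> S \<Longrightarrow> y \<in> S \<Longrightarrow> x + y \<in> S"
  shows "additive_on T (inv_into S f)"
  unfolding additive_on_def
proof (intro ballI)
  fix x y assume xy: "x \<in> T" "y \<in> T"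
  define a b where "a = inv_into S f x" and "b = inv_into S f y"
  have ab: "a \<in> S" "b \<in> S" "f a = x" "f b = y"
    using xy bij by (auto simp: a_def b_def bij_betw_def inv_into_into f_inv_into_f)
  then have "inv_into S f (x + y) = inv_into S f (f (a + b))" using add by (simp add: additive_on_def)
  also have "\<dots> = a + b" using bij ab cl by (simp add: bij_betw_def inv_into_f_f)
  finally show "inv_into S f (x + y) = inv_into S f x + inv_into S f y" by (simp add: a_def b_def)
qed

lemma ziso_inv:
  assumes m: "FH_family m" and f: "ziso (dsum m) M f"
  shows "ziso M (dsum m) (inv_into (Top (dsum m)) (fst f), inv_into (Bot (dsum m)) (snd f))"
proof -
  have h: "zhom (dsum m) M f" and bT: "bij_betw (fst f) (Top (dsum m)) (Top M)"
    and bB: "bij_betw (snd f) (Bot (dsum m)) (Bot M)" using f by (auto simp: ziso_def)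
  let ?g = "inv_into (Top (dsum m)) (fst f)" and ?k = "inv_into (Bot (dsum m)) (snd f)"
  have aT: "additive_on (Top M) ?g" by (rule additive_inv_into[OF bT]) (use h FH_closed[OF m] in \<open>auto simp: zhom_def\<close>)
  have aB: "additive_on (Bot M) ?k" by (rule additive_inv_into[OF bB]) (use h FH_closed[OF m] in \<open>auto simp: zhom_def\<close>)
  have g: "?g x \<in> Top (dsum m)" "fst f (?g x) = x" if "x \<in> Top M" for x
    using that bT by (auto simp: bij_betw_def inv_into_into f_inv_into_f)
  have k: "?k x \<in> Bot (dsum m)" "snd f (?k x) = x" if "x \<in> Bot M" for x
    using that bB by (auto simp: bij_betw_def inv_into_into f_inv_into_f)
  have gf: "?g (fst f v) = v" if "v \<in> Top (dsum m)" for v using that bT by (simp add: bij_betw_def)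
  have kf: "?k (snd f v) = v" if "v \<in> Bot (dsum m)" for v using that bB by (simp add: bij_betw_def)
  have "?g (tr M x) = tr (dsum m) (?g x)" if "x \<in> Top M" for x
  proof -
    have "tr M x = fst f (tr (dsum m) (?g x))" using h g[OF that] by (auto simp: zhom_def)
    then show ?thesis using gf FH_closed(3)[OF m g(1)[OF that]] by metis
  qed
  moreover have "?g (res M z) = res (dsum m) (?k z)" if "z \<in> Bot M" for z
  proof -
    have "res M z = fst f (res (dsum m) (?k z))" using h k[OF that] by (auto simp: zhom_def)
    then show ?thesis using gf FH_closed(4)[OF m k(1)[OF that]] by metis
  qed
  moreover have "?k (ind M x) = ind (dsum m) (?g x)" if "x \<in> Top M" for x
  proof -
    have "ind M x = snd f (ind (dsum m) (?g x))" using h g[OF that] by (auto simp: zhom_def)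
    then show ?thesis using kf FH_closed(5)[OF m g(1)[OF that]] by metis
  qed
  ultimately have "zhom M (dsum m) (?g, ?k)"
    using aT aB g(1) k(1) unfolding zhom_def fst_conv snd_conv by blast
  then show ?thesis using bij_betw_inv_into[OF bT] bij_betw_inv_into[OF bB] by (simp add: ziso_def)
qed

text \<open>Above the bottom only copies of \<open>F\<close> can occur until the strand stops or
  ends in a copy of \<open>H\<close>. So the first index \<open>n \<ge> 1\<close> without
  \<open>F\<close>, together with \<open>sh 0\<close> and \<open>sh n\<close>, determines the kind,
  and absence of such an index means \<open>KAinf\<close> or \<open>KBinf\<close>.
  \<open>KDF\<close> is avoided since it has the same shapes as \<open>KA 1\<close>; only the
  differential separates the two.\<close>

lemma kind_of_shape:
  fixes sh :: "nat \<Rightarrow> shape"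
  assumes sh0: "sh 0 \<noteq> SZ" and SZ: "\<And>n. sh n = SZ \<Longrightarrow> sh (Suc n) = SZ"
    and SH: "\<And>n. sh (Suc n) = SH \<Longrightarrow> sh (Suc (Suc n)) = SZ"
  shows "\<exists>\<kappa> s. \<kappa> \<noteq> KDF \<and> (\<forall>i. kshape \<kappa> (i - s) = (if i < 0 then SZ else sh (nat i)))"
proof (cases "\<exists>n\<ge>1. sh n \<noteq> SF")
  case False
  then have F: "sh n = SF" if "n \<ge> 1" for n using that by blast
  consider "sh 0 = SF" | "sh 0 = SH" using sh0 by (cases "sh 0") auto
  then show ?thesis
  proof cases
    case 1
    then have "sh n = SF" for n using F by (cases "n = 0") auto
    then show ?thesis by (intro exI[of _ KAinf] exI[of _ 0]) auto
  next
    case 2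
    then show ?thesis using F by (intro exI[of _ KBinf] exI[of _ 0]) auto
  qed
next
  case True
  define n where "n = (LEAST n. n \<ge> 1 \<and> sh n \<noteq> SF)"
  have n: "n \<ge> 1" "sh n \<noteq> SF" using LeastI_ex[OF True[unfolded]] unfolding n_def by auto
  have F: "sh k = SF" if "1 \<le> k" "k < n" for k
    using not_less_Least[of k "\<lambda>n. n \<ge> 1 \<and> sh n \<noteq> SF"] that by (auto simp: n_def)
  have Zup: "sh (k + l) = SZ" if "sh k = SZ" for k l using that SZ by (induction l) auto
  have Z: "sh k = SZ" if "k > n" for k
  proof -
    have "sh (Suc n) = SZ"
    proof (cases "sh n")
      case SH
      then show ?thesis using assms(3)[of "n - 1"] n by simp
    qed (use n SZ in auto)
    then have "sh (Suc n + (k - Suc n)) = SZ" by (rule Zup)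
    then show ?thesis using that by simp
  qed
  have shk: "(if i < 0 then SZ else sh (nat i)) =
      (if i < 0 then SZ else if i = 0 then sh 0 else if i < int n then SF else if i = int n then sh n else SZ)" for i
    using F[of "nat i"] Z[of "nat i"] n(1) by (auto simp: nat_less_iff zless_nat_eq_int_zless)
  \<comment> \<open>The shifts below account for conventions: \<open>KB r\<close>, and
    \<open>KH n\<close> for positive \<open>n\<close>, have their top in degree 0, the other kinds
    their bottom.\<close>
  consider "sh 0 = SF" "sh n = SZ" | "sh 0 = SF" "sh n = SH" | "sh 0 = SH" "sh n = SZ"
    | "sh 0 = SH" "sh n = SH" "n = 1" | "sh 0 = SH" "sh n = SH" "n \<ge> 2"
    using sh0 n by (cases "sh 0"; cases "sh n"; fastforce)
  then show ?thesis
    unfolding shk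
  proof cases
    case 1
    then show "\<exists>\<kappa> s. \<kappa> \<noteq> KDF \<and> (\<forall>i. kshape \<kappa> (i - s) = (if i < 0 then SZ else if i = 0 then sh 0
      else if i < int n then SF else if i = int n then sh n else SZ))"
      using n by (intro exI[of _ "KA (n - 1)"] exI[of _ 0]) (auto simp: of_nat_diff)
  next
    case 2
    then show "\<exists>\<kappa> s. \<kappa> \<noteq> KDF \<and> (\<forall>i. kshape \<kappa> (i - s) = (if i < 0 then SZ else if i = 0 then sh 0
      else if i < int n then SF else if i = int n then sh n else SZ))"
      using n by (intro exI[of _ "KH (- int n)"] exI[of _ 0]) auto
  next
    case 3
    then show "\<exists>\<kappa> s. \<kappa> \<noteq> KDF \<and> (\<forall>i. kshape \<kappa> (i - s) = (if i < 0 then SZ else if i = 0 then sh 0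
      else if i < int n then SF else if i = int n then sh n else SZ))"
      using n by (intro exI[of _ "KH (int n - 1)"] exI[of _ "int n - 1"]) auto
  next
    case 4
    then show "\<exists>\<kappa> s. \<kappa> \<noteq> KDF \<and> (\<forall>i. kshape \<kappa> (i - s) = (if i < 0 then SZ else if i = 0 then sh 0
      else if i < int n then SF else if i = int n then sh n else SZ))"
      by (intro exI[of _ KDH] exI[of _ 0]) auto
  next
    case 5
    then show "\<exists>\<kappa> s. \<kappa> \<noteq> KDF \<and> (\<forall>i. kshape \<kappa> (i - s) = (if i < 0 then SZ else if i = 0 then sh 0
      else if i < int n then SF else if i = int n then sh n else SZ))"
      by (intro exI[of _ "KB (n - 2)"] exI[of _ "int n"]) (auto simp: of_nat_diff)
  qed
qed

text \<open>As a simp rule this would turn every sum of bits into a case distinction.\<close>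
declare add_bit_eq_xor [simp del]

section \<open>Coordinates with respect to a set of generators\<close>

definition bsm :: "bit \<Rightarrow> 'a::ab_group_add \<Rightarrow> 'a" where
  "bsm a x = (if a = 0 then 0 else x)"

lemma bsm_0 [simp]: "bsm 0 x = 0" and bsm_1 [simp]: "bsm 1 x = x" and bsm_zero [simp]: "bsm a 0 = 0"
  by (auto simp: bsm_def)

lemma bsm_add: "f2_space S \<Longrightarrow> x \<in> S \<Longrightarrow> bsm (a + b) x = bsm a x + bsm b x"
  using f2_double[of S x] by (cases a; cases b) auto

lemma bsm_in: "f2_space S \<Longrightarrow> x \<in> S \<Longrightarrow> bsm a x \<in> S"
  by (simp add: bsm_def f2_zero)

lemma additive_bsm: "f2_space S \<Longrightarrow> additive_on S h \<Longrightarrow> h (bsm a x) = bsm a (h x)"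
  by (simp add: bsm_def additive_zero)

context nice_complex
begin

text \<open>The \<open>Top\<close> element with coordinates \<open>v\<close> in the summand
  represented by \<open>x\<close>: the basis is \<open>e\<close>, \<open>tr e\<close> for a
  generator \<open>e\<close> of \<open>F\<close>, recovered from \<open>x = io i e\<close>, and
  \<open>rho i x\<close> for \<open>H\<close>. The second coordinate is ignored for
  \<open>H\<close>, whose \<open>Top\<close> level is modelled with 0 there.\<close>

definition coefT :: "int \<Rightarrow> 'a set \<Rightarrow> 'b \<Rightarrow> bit \<times> bit \<Rightarrow> 'a" where
  "coefT i E x v = (if x \<in> io i ` E
     then bsm (fst v) (inv_into E (io i) x) + bsm (snd v) (tr (C i) (inv_into E (io i) x))
     else bsm (fst v) (rho i x))"

lemma lift:
  assumes "gens i E G" "x \<in> io i ` E"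
  shows "inv_into E (io i) x \<in> E" "inv_into E (io i) x \<in> T i" "io i (inv_into E (io i) x) = x"
  using assms by (auto simp: gens_def inv_into_into f_inv_into_f)

lemma gens_B: "gens i E G \<Longrightarrow> x \<in> io i ` E \<union> G \<Longrightarrow> x \<in> B i"
  unfolding gens_def basis2_def by blast

lemma coefT_in:
  assumes "gens i E G" "x \<in> io i ` E \<union> G"
  shows "coefT i E x v \<in> T i"
  using lift[OF assms(1)] gens_B[OF assms]
  by (auto simp: coefT_def intro!: f2_add[OF T_f2] bsm_in[OF T_f2] tr_in rho_in)

lemma coefT_add:
  assumes "gens i E G" "x \<in> io i ` E \<union> G"
  shows "coefT i E x (v + v') = coefT i E x v + coefT i E x v'"
proof (cases "x \<in> io i ` E")
  case True
  note e = lift(2)[OF assms(1) True]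
  show ?thesis
    using True by (simp add: coefT_def bsm_add[OF T_f2 e] bsm_add[OF T_f2 tr_in[OF e]] algebra_simps)
next
  case False
  then show ?thesis by (simp add: coefT_def bsm_add[OF T_f2 rho_in[OF gens_B[OF assms]]])
qed

lemma coefT_tr:
  assumes "gens i E G" "x \<in> io i ` E \<union> G"
  shows "tr (C i) (coefT i E x v) = coefT i E x (if x \<in> io i ` E then (snd v, fst v) else v)"
proof (cases "x \<in> io i ` E")
  case True
  note e = lift(2)[OF assms(1) True]
  have "tr (C i) (coefT i E x v) = tr (C i) (bsm (fst v) (inv_into E (io i) x))
      + tr (C i) (bsm (snd v) (tr (C i) (inv_into E (io i) x)))"
    using True additive_onD[OF tr_add bsm_in[OF T_f2 e] bsm_in[OF T_f2 tr_in[OF e]]] by (simp add: coefT_def)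
  then show ?thesis
    using True by (simp add: coefT_def additive_bsm[OF T_f2 tr_add] tr_tr[OF e] add.commute)
next
  case False
  then show ?thesis by (simp add: coefT_def additive_bsm[OF T_f2 tr_add] tr_rho[OF gens_B[OF assms]])
qed

lemma coefT_io:
  assumes "gens i E G" "x \<in> io i ` E \<union> G"
  shows "io i (coefT i E x v) = (if x \<in> io i ` E then bsm (fst v + snd v) x else 0)"
proof (cases "x \<in> io i ` E")
  case True
  note e = lift(2,3)[OF assms(1) True]
  have "io i (coefT i E x v) = io i (bsm (fst v) (inv_into E (io i) x))
      + io i (bsm (snd v) (tr (C i) (inv_into E (io i) x)))"
    using True additive_onD[OF io_add bsm_in[OF T_f2 e(1)] bsm_in[OF T_f2 tr_in[OF e(1)]]] by (simp add: coefT_def)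
  then show ?thesis
    using True by (simp add: additive_bsm[OF T_f2 io_add] io_tr[OF e(1)] e(2) bsm_add[OF B_f2 gens_B[OF assms]])
next
  case False
  then show ?thesis by (simp add: coefT_def additive_bsm[OF T_f2 io_add] io_rho[OF gens_B[OF assms]])
qed

lemma rho_bsm:
  assumes "gens i E G" "x \<in> io i ` E \<union> G"
  shows "rho i (bsm c x) = coefT i E x (if x \<in> io i ` E then (c, c) else (c, 0))"
proof (cases "x \<in> io i ` E")
  case True
  note e = lift(2,3)[OF assms(1) True]
  have "rho i x = inv_into E (io i) x + tr (C i) (inv_into E (io i) x)" using rho_io[OF e(1)] e(2) by simp
  then show ?thesis using True by (cases c) (simp_all add: coefT_def rho_0)
next
  case False
  then show ?thesis by (simp add: coefT_def additive_bsm[OF B_f2 rho_add])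
qed

text \<open>At the \<open>Bot\<close> level bijectivity is the basis property. It passes to the
  \<open>Top\<close> level as in the five lemma, since on both sides \<open>res\<close> is injective
  with image the kernel of \<open>ind\<close>; the images of \<open>ind\<close> match because
  \<open>io i\<close> E\<open>spans\<close>io i \<open>T i\<close>. The index set \<open>I\<close>
  is arbitrary so that one numbering of the strands can serve all degrees.\<close>

lemma dsum_iso:
  fixes xx :: "nat \<Rightarrow> 'b"
  assumes g: "gens i E G" and I: "finite I" and xx: "bij_betw xx I (io i ` E \<union> G)"
    and m: "\<And>j. m j = (if j \<in> I then if xx j \<in> io i ` E then zF else zH else zZ)"
  shows "ziso (dsum m) (C i) ((\<lambda>v. \<Sum>j\<in>I. coefT i E (xx j) (v j)), (\<lambda>w. \<Sum>j\<in>I. bsm (w j) (xx j)))"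
proof -
  let ?X = "io i ` E \<union> G"
  define fT where "fT v = (\<Sum>j\<in>I. coefT i E (xx j) (v j))" for v
  define fB where "fB w = (\<Sum>j\<in>I. bsm (w j) (xx j))" for w
  have "{j. m j \<noteq> zZ} \<subseteq> I" using m by auto
  then have fam: "FH_family m" unfolding FH_family_def using m finite_subset[OF _ I] by auto
  have xX: "xx j \<in> ?X" if "j \<in> I" for j using xx that by (auto simp: bij_betw_def)
  have xB: "xx j \<in> B i" if "j \<in> I" for j using gens_B[OF g xX[OF that]] .
  note cin = coefT_in[OF g xX]
  have fT_in: "fT v \<in> T i" for v unfolding fT_def by (rule f2_sum[OF T_f2 cin])
  have fB_in: "fB w \<in> B i" for w unfolding fB_def by (rule f2_sum[OF B_f2 bsm_in[OF B_f2 xB]])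
  have fT_add: "fT (v + v') = fT v + fT v'" for v v'
    unfolding fT_def sum.distrib[symmetric] by (rule sum.cong) (simp_all add: coefT_add[OF g xX])
  have fB_add: "fB (w + w') = fB w + fB w'" for w w'
    unfolding fB_def sum.distrib[symmetric] by (rule sum.cong) (simp_all add: bsm_add[OF B_f2 xB])
  have tr: "fT (tr (dsum m) v) = tr (C i) (fT v)" for v
  proof -
    have "tr (C i) (fT v) = (\<Sum>j\<in>I. tr (C i) (coefT i E (xx j) (v j)))"
      unfolding fT_def by (rule additive_sum[OF T_f2 tr_add cin])
    also have "\<dots> = fT (tr (dsum m) v)"
      unfolding fT_def by (rule sum.cong) (simp_all add: coefT_tr[OF g xX] m case_prod_beta)
    finally show ?thesis by simp
  qed
  have res: "fT (res (dsum m) w) = rho i (fB w)" for w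
  proof -
    have "rho i (fB w) = (\<Sum>j\<in>I. rho i (bsm (w j) (xx j)))"
      unfolding fB_def by (rule additive_sum[OF B_f2 rho_add bsm_in[OF B_f2 xB]])
    also have "\<dots> = fT (res (dsum m) w)"
      unfolding fT_def by (rule sum.cong) (simp_all add: rho_bsm[OF g xX] m)
    finally show ?thesis by simp
  qed
  have ind: "fB (ind (dsum m) v) = io i (fT v)" for v
  proof -
    have "io i (fT v) = (\<Sum>j\<in>I. io i (coefT i E (xx j) (v j)))"
      unfolding fT_def by (rule additive_sum[OF T_f2 io_add cin])
    also have "\<dots> = fB (ind (dsum m) v)"
      unfolding fB_def by (rule sum.cong) (simp_all add: coefT_io[OF g xX] m case_prod_beta)
    finally show ?thesis by simp
  qed
  have inj_xx: "inj_on xx I" using xx by (simp add: bij_betw_def)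
  have indepX: "indep2 ?X" and spanX: "span2 ?X = B i" using g by (auto simp: gens_def basis2_def)
  have fB_sub: "fB w = \<Sum>(xx ` {j \<in> I. w j \<noteq> 0})" for w
  proof -
    have "fB w = (\<Sum>j\<in>{j \<in> I. w j \<noteq> 0}. xx j)"
      unfolding fB_def by (rule sum.mono_neutral_cong_right[OF I]) (auto simp: bsm_def)
    also have "\<dots> = \<Sum>(xx ` {j \<in> I. w j \<noteq> 0})"
      using inj_on_subset[OF inj_xx, of "{j \<in> I. w j \<noteq> 0}"] by (simp add: sum.reindex)
    finally show ?thesis .
  qed
  have fB_ker: "w = 0" if w: "w \<in> Bot (dsum m)" "fB w = 0" for w
  proof -
    have "xx ` {j \<in> I. w j \<noteq> 0} = {}"
    proof (rule indep2D[OF indepX])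
      show "finite (xx ` {j \<in> I. w j \<noteq> 0})" using I by simp
      show "xx ` {j \<in> I. w j \<noteq> 0} \<subseteq> ?X" using xX by blast
      show "\<Sum>(xx ` {j \<in> I. w j \<noteq> 0}) = 0" using w(2) unfolding fB_sub .
    qed
    then have "w j = 0" if "j \<in> I" for j using that by blast
    moreover have "w j = 0" if "j \<notin> I" for j
      using w(1)[unfolded FH_Bot[OF fam], rule_format, of j] that by (simp add: m)
    ultimately show ?thesis unfolding fun_eq_iff zero_fun_def by blast
  qed
  have fB_surj: "\<exists>w. (\<forall>j. w j \<noteq> 0 \<longrightarrow> j \<in> I \<and> xx j \<in> Y) \<and> fB w = \<Sum>Y" if Y: "Y \<subseteq> ?X" for Y
  proof (intro exI conjI allI impI)
    let ?w = "\<lambda>j. if j \<in> I \<and> xx j \<in> Y then 1 else (0::bit)"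
    show "j \<in> I" "xx j \<in> Y" if "?w j \<noteq> 0" for j using that by (auto split: if_splits)
    have "xx ` I = ?X" using xx by (simp add: bij_betw_def)
    then have "xx ` {j \<in> I. ?w j \<noteq> 0} = Y" using Y by force
    then show "fB ?w = \<Sum>Y" unfolding fB_sub by simp
  qed
  have fB_surjB: "\<exists>w\<in>Bot (dsum m). fB w = z" if "z \<in> B i" for z
  proof -
    have "z \<in> span2 ?X" using that spanX by simp
    then obtain Y where Y: "Y \<subseteq> ?X" "z = \<Sum>Y" by (rule span2E)
    obtain w where w: "\<forall>j. w j \<noteq> 0 \<longrightarrow> j \<in> I \<and> xx j \<in> Y" "fB w = \<Sum>Y" using fB_surj[OF Y(1)] by blast
    have "w j \<in> Bot (m j)" for j using w(1)[rule_format, of j] by (cases "w j = 0") (auto simp: m)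
    then show ?thesis using w Y FH_Bot[OF fam] by blast
  qed
  have selfB: "w + w = 0" for w :: "nat \<Rightarrow> bit" by (simp add: fun_eq_iff bit_add_self)
  have selfT: "v + v = 0" for v :: "nat \<Rightarrow> bit \<times> bit" by (simp add: fun_eq_iff prod_eq_iff bit_add_self)
  have fB_0: "fB 0 = 0" by (simp add: fB_def)
  have fT_0: "fT 0 = 0" unfolding fT_def by (rule sum.neutral) (simp add: coefT_def)
  have fT_ker: "v = 0" if v: "v \<in> Top (dsum m)" "fT v = 0" for v
  proof -
    have "fB (ind (dsum m) v) = 0" using ind v(2) io_0 by simp
    then have "ind (dsum m) v = 0" using fB_ker FH_closed(5)[OF fam v(1)] by blast
    then obtain w where w: "w \<in> Bot (dsum m)" "v = res (dsum m) w" using FH_ind_ker[OF fam v(1)] by blast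
    then have "rho i (fB w) = rho i 0" using res v(2) rho_0 by metis
    then have "fB w = 0" using rho_inj fB_in f2_zero[OF B_f2] by blast
    then have "w = 0" using fB_ker w(1) by blast
    then show ?thesis using w(2) by (auto simp: fun_eq_iff m zero_prod_def)
  qed
  have fT_surj: "\<exists>v\<in>Top (dsum m). fT v = y" if y: "y \<in> T i" for y
  proof -
    have "io i y \<in> span2 (io i ` E)" using g y by (auto simp: gens_def)
    then obtain Y where Y: "Y \<subseteq> io i ` E" "io i y = \<Sum>Y" by (rule span2E)
    have "Y \<subseteq> ?X" using Y(1) by blast
    then obtain w where w: "\<forall>j. w j \<noteq> 0 \<longrightarrow> j \<in> I \<and> xx j \<in> Y" "fB w = \<Sum>Y" using fB_surj by blast
    define v where "v j = (w j, 0::bit)" for j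
    have vw: "v j \<in> Top (m j) \<and> ind (m j) (v j) = w j" for j
    proof (cases "w j = 0")
      case True
      then show ?thesis by (simp add: m v_def zero_prod_def)
    next
      case False
      then have "j \<in> I \<and> xx j \<in> io i ` E" using w(1) Y(1) by blast
      then show ?thesis by (simp add: m v_def)
    qed
    then have v: "v \<in> Top (dsum m)" using FH_Top[OF fam] by blast
    have "ind (dsum m) v = w" using vw by (simp add: fun_eq_iff)
    then have "io i (fT v) = io i y" using ind w(2) Y(2) by metis
    then have "io i (fT v + y) = io i y + io i y" using additive_onD[OF io_add fT_in y] by simp
    also have "\<dots> = 0" by (rule f2_double[OF B_f2 io_in[OF y]])
    finally obtain z where z: "z \<in> B i" "fT v + y = rho i z" using io_ker f2_add[OF T_f2 fT_in y] by blast
    obtain w' where w': "w' \<in> Bot (dsum m)" "fB w' = z" using fB_surjB[OF z(1)] by blast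
    have "fT (v + res (dsum m) w') = fT v + (fT v + y)" using fT_add res w'(2) z(2) by simp
    also have "\<dots> = y" by (rule f2_cancel[OF T_f2 fT_in])
    finally show ?thesis using FH_closed(1)[OF fam v FH_closed(4)[OF fam w'(1)]] by blast
  qed
  have "inj_on fB (Bot (dsum m))"
  proof (rule inj_onI)
    fix w w' assume *: "w \<in> Bot (dsum m)" "w' \<in> Bot (dsum m)" "fB w = fB w'"
    have "fB (w + w') = fB (w' + w')" by (simp only: fB_add *(3))
    then have "fB (w + w') = 0" by (simp only: selfB fB_0)
    then have "w + w' = 0" using fB_ker FH_closed(2)[OF fam *(1,2)] by blast
    then show "w = w'" using selfB[of w'] by (metis add_right_cancel)
  qed
  then have bB: "bij_betw fB (Bot (dsum m)) (B i)"
    using fB_in fB_surjB unfolding bij_betw_def by blast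
  have "inj_on fT (Top (dsum m))"
  proof (rule inj_onI)
    fix v v' assume *: "v \<in> Top (dsum m)" "v' \<in> Top (dsum m)" "fT v = fT v'"
    have "fT (v + v') = fT (v' + v')" by (simp only: fT_add *(3))
    then have "fT (v + v') = 0" by (simp only: selfT fT_0)
    then have "v + v' = 0" using fT_ker FH_closed(1)[OF fam *(1,2)] by blast
    then show "v = v'" using selfT[of v'] by (metis add_right_cancel)
  qed
  then have bT: "bij_betw fT (Top (dsum m)) (T i)"
    using fT_in fT_surj unfolding bij_betw_def by blast
  have "zhom (dsum m) (C i) (fT, fB)"
    unfolding zhom_def fst_conv snd_conv additive_on_def
    using fT_in fB_in fT_add fB_add tr res ind by blast
  then have "ziso (dsum m) (C i) (fT, fB)" using bB bT by (simp add: ziso_def)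
  moreover have "fT = (\<lambda>v. \<Sum>j\<in>I. coefT i E (xx j) (v j))" "fB = (\<lambda>w. \<Sum>j\<in>I. bsm (w j) (xx j))"
    by (simp_all add: fun_eq_iff fT_def fB_def)
  ultimately show ?thesis by simp
qed

end

section \<open>Strands\<close>

lemma kdiff_closed:
  shows "a \<in> Top (shape_mod (kshape k i)) \<Longrightarrow> fst (kdiff k i) a \<in> Top (shape_mod (kshape k (i - 1)))"
    and "c \<in> Bot (shape_mod (kshape k i)) \<Longrightarrow> snd (kdiff k i) c \<in> Bot (shape_mod (kshape k (i - 1)))"
proof -
  obtain s s' where ss: "kshape k i = s" "kshape k (i - 1) = s'" by blast
  show "a \<in> Top (shape_mod (kshape k i)) \<Longrightarrow> fst (kdiff k i) a \<in> Top (shape_mod (kshape k (i - 1)))"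
    unfolding kdiff_def ss
    by (cases s; cases s') (simp_all add: map_u_def map_id_def map_pFH_def map_pHF_def map_zero_def case_prod_beta zero_prod_def)
  show "c \<in> Bot (shape_mod (kshape k i)) \<Longrightarrow> snd (kdiff k i) c \<in> Bot (shape_mod (kshape k (i - 1)))"
    unfolding kdiff_def ss
    by (cases s; cases s') (simp_all add: map_u_def map_id_def map_pFH_def map_pHF_def map_zero_def case_prod_beta)
qed

locale strand_complex = nice_complex +
  fixes E :: "int \<Rightarrow> 'a set" and G :: "int \<Rightarrow> 'b set" and N :: int
  assumes g: "gens i (E i) (G i)" and lnk: "linked i (E i) (G i) (E (i - 1)) (G (i - 1))"
    and low: "i < N \<Longrightarrow> E i = {} \<and> G i = {}"
begin

definition Xs where "Xs i = io i ` E i \<union> G i"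
definition ep where "ep i x = inv_into (E i) (io i) x"
text \<open>\<open>tgt\<close> alone also holds for \<open>x = 0\<close> when the differential of a
  generator of \<open>H\<close> vanishes. Requiring \<open>x\<close> to be a generator excludes
  this.\<close>

definition lk where "lk i x' x \<longleftrightarrow> tgt i (E i) (G i) (E (i - 1)) x' x \<and> x \<in> Xs (i - 1)"

lemma Xs_B: "x \<in> Xs i \<Longrightarrow> x \<in> B i"
  using gens_B[OF g] unfolding Xs_def .

lemma Xs_nz: "x \<in> Xs i \<Longrightarrow> x \<noteq> 0"
  using indep2_nonzero[of "Xs i"] g[of i] unfolding gens_def basis2_def Xs_def by blast

lemma finite_Xs: "finite (Xs i)"
  using Xs_B fin_B[of i] by (meson finite_subset subsetI)

lemma EG_disj: "x \<in> io i ` E i \<Longrightarrow> x \<notin> G i"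
  using g[of i] unfolding gens_def by blast

lemma ep: "x \<in> io i ` E i \<Longrightarrow> ep i x \<in> E i" "x \<in> io i ` E i \<Longrightarrow> ep i x \<in> T i"
    "x \<in> io i ` E i \<Longrightarrow> io i (ep i x) = x"
  using lift[OF g[of i]] unfolding ep_def by blast+

lemma ep_io: "e \<in> E i \<Longrightarrow> ep i (io i e) = e"
  using g[of i] unfolding ep_def gens_def by (simp add: inv_into_f_f)

lemma lk_Xs: "lk i x' x \<Longrightarrow> x' \<in> Xs i" "lk i x' x \<Longrightarrow> x \<in> Xs (i - 1)"
  unfolding lk_def tgt_def Xs_def by auto

lemma lk_cases:
  assumes "lk i x' x"
  obtains (id) "x' \<in> io i ` E i" "x \<in> io (i - 1) ` E (i - 1)" "dT i (ep i x') = ep (i - 1) x" "dB i x' = x"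
  | (u) "x' \<in> io i ` E i" "dT i (ep i x') = rho (i - 1) x" "dB i x' = 0"
  | (h) "x' \<in> G i" "dB i x' = x"
proof -
  from assms consider (e) e where "e \<in> E i" "x' = io i e" "dT i e \<in> E (i - 1)" "x = io (i - 1) (dT i e)"
    | (r) e where "e \<in> E i" "x' = io i e" "dT i e = rho (i - 1) x"
    | (g) "x' \<in> G i" "x = dB i x'" unfolding lk_def tgt_def by blast
  then show thesis
  proof cases
    case e
    have "e \<in> T i" using e(1,2) ep(2)[of x' i] ep_io[of e i] by simp
    then have "dB i x' = x" using e dB_io by simp
    then show thesis using e ep_io[of e i] ep_io[of "dT i e" "i - 1"] by (intro id) simp_all
  next
    case r
    have "e \<in> T i" using r(1,2) ep(2)[of x' i] ep_io[of e i] by simp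
    then have "dB i x' = io (i - 1) (rho (i - 1) x)" using r dB_io by simp
    also have "\<dots> = 0" by (rule io_rho[OF Xs_B[OF lk_Xs(2)[OF assms]]])
    finally show thesis using r ep_io[of e i] by (intro u) simp_all
  next
    case g
    then show thesis by (intro h) simp_all
  qed
qed

lemma lk_or_zero:
  assumes "x' \<in> Xs i" "\<nexists>x. lk i x' x"
  shows "x' \<in> io i ` E i \<and> dT i (ep i x') = 0 \<or> x' \<in> G i \<and> dB i x' = 0"
proof (cases "x' \<in> io i ` E i")
  case True
  note e = ep(1,3)[OF True]
  consider "dT i (ep i x') = 0" | "dT i (ep i x') \<in> E (i - 1)"
    | x where "x \<in> Xs (i - 1)" "dT i (ep i x') = rho (i - 1) x"
    using lnk[of i] e(1) unfolding linked_def Xs_def by blast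
  then show ?thesis
  proof cases
    case 1
    then show ?thesis using True by blast
  next
    case 2
    then have "lk i x' (io (i - 1) (dT i (ep i x')))"
      unfolding lk_def tgt_def Xs_def using e by (metis UnI1 imageI)
    then show ?thesis using assms(2) by blast
  next
    case 3
    then have "lk i x' x" unfolding lk_def tgt_def using e by metis
    then show ?thesis using assms(2) by blast
  qed
next
  case False
  then have G: "x' \<in> G i" using assms(1) by (simp add: Xs_def)
  have "dB i x' = 0 \<or> lk i x' (dB i x')"
    using lnk[of i] G unfolding linked_def lk_def tgt_def Xs_def by blast
  then show ?thesis using assms(2) G by blast
qed

lemma lk_up: "lk i a x \<Longrightarrow> lk i b x \<Longrightarrow> a = b"
  using lnk[of i] unfolding linked_def lk_def Xs_def by blast

text \<open>If \<open>dB\<close> of the upper generator is nonzero, it is the target. Otherwise the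
  link is \<open>u\<close> or \<open>p\<close> out of \<open>F\<close>, and injectivity of
  \<open>rho\<close> determines the target.\<close>

lemma lk_down:
  assumes "lk i a x" "lk i a z"
  shows "x = z"
proof -
  have nz: "x \<noteq> 0" "z \<noteq> 0" using Xs_nz lk_Xs(2) assms by blast+
  have B: "x \<in> B (i - 1)" "z \<in> B (i - 1)" using Xs_B lk_Xs(2) assms by blast+
  show ?thesis using assms(1)
  proof (cases rule: lk_cases)
    case id
    note x = this
    show ?thesis using assms(2) by (cases rule: lk_cases) (use x nz in auto)
  next
    case u
    note x = this
    show ?thesis using assms(2)
    proof (cases rule: lk_cases)
      case u
      then show ?thesis using x rho_inj[OF B] by simp
    qed (use x nz in auto)
  next
    case h
    note x = this
    show ?thesis using assms(2) by (cases rule: lk_cases) (use x nz in auto)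
  qed
qed

text \<open>A consequence of \<open>d\<close> squaring to zero. Links by an identity or out of
  \<open>H\<close> have nonzero \<open>dB\<close>, so they can only start at the top of a
  strand.\<close>

lemma lk_dB_zero:
  assumes "lk i y x"
  shows "dB (i - 1) x = 0"
proof -
  have y: "y \<in> B i" "x \<in> B (i - 1)" using Xs_B lk_Xs assms by blast+
  show ?thesis using assms
  proof (cases rule: lk_cases)
    case id
    then show ?thesis using dB_dB[OF y(1)] by simp
  next
    case u
    have "rho (i - 1 - 1) (dB (i - 1) x) = 0"
      using dT_dT[OF ep(2)[OF u(1)]] u(2) dT_rho[OF y(2)] by simp
    then show ?thesis using rho_inj[OF dB_in[OF y(2)] f2_zero[OF B_f2]] rho_0 by simp
  next
    case h
    then show ?thesis using dB_dB[OF y(1)] by simp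
  qed
qed

text \<open>\<open>sq s b n\<close> is the generator in degree \<open>s + n\<close> of the strand whose lowest generator is \<open>b\<close> in degree \<open>s\<close>;
  \<open>None\<close> above the top of the strand.\<close>

primrec sq :: "int \<Rightarrow> 'b \<Rightarrow> nat \<Rightarrow> 'b option" where
  "sq s b 0 = Some b"
| "sq s b (Suc n) = (case sq s b n of None \<Rightarrow> None
     | Some x \<Rightarrow> if \<exists>y. lk (s + 1 + int n) y x then Some (SOME y. lk (s + 1 + int n) y x) else None)"

lemma sq_Suc: "sq s b (Suc n) = Some y \<longleftrightarrow> (\<exists>x. sq s b n = Some x \<and> lk (s + 1 + int n) y x)"
proof
  assume "sq s b (Suc n) = Some y"
  then obtain x where x: "sq s b n = Some x" "\<exists>y. lk (s + 1 + int n) y x" "y = (SOME y. lk (s + 1 + int n) y x)"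
    by (auto split: option.splits if_splits)
  then show "\<exists>x. sq s b n = Some x \<and> lk (s + 1 + int n) y x" using someI_ex[OF x(2)] by auto
next
  assume "\<exists>x. sq s b n = Some x \<and> lk (s + 1 + int n) y x"
  then obtain x where x: "sq s b n = Some x" "lk (s + 1 + int n) y x" by auto
  have "(SOME y. lk (s + 1 + int n) y x) = y" using lk_up[OF _ x(2)] someI[of "\<lambda>y. lk (s + 1 + int n) y x", OF x(2)] by blast
  then show "sq s b (Suc n) = Some y" using x by auto
qed

definition el :: "int \<times> 'b \<Rightarrow> int \<Rightarrow> 'b option" where
  "el p i = (if i < fst p then None else sq (fst p) (snd p) (nat (i - fst p)))"

lemma el_base: "el p (fst p) = Some (snd p)"
  by (simp add: el_def)

lemma el_low: "el p i = Some x \<Longrightarrow> fst p \<le> i"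
  by (auto simp: el_def split: if_splits)

lemma el_step:
  assumes "fst p < i"
  shows "el p i = Some y \<longleftrightarrow> (\<exists>x. el p (i - 1) = Some x \<and> lk i y x)"
proof -
  define n where "n = nat (i - 1 - fst p)"
  have n: "nat (i - fst p) = Suc n" "nat (i - 1 - fst p) = n" "fst p + 1 + int n = i"
    using assms by (auto simp: n_def)
  show ?thesis using assms sq_Suc[of "fst p" "snd p" n y] by (simp add: el_def n del: sq.simps)
qed

lemma el_stepD: "el p i = Some y \<Longrightarrow> el p (i - 1) = Some x \<Longrightarrow> lk i y x"
  using el_step[of p i y] el_low[of p "i - 1" x] by fastforce

lemma el_None_up:
  assumes "fst p \<le> i" "el p i = None"
  shows "el p (i + int n) = None"
proof (induction n)
  case (Suc n)
  show ?case
  proof (rule ccontr)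
    assume "el p (i + int (Suc n)) \<noteq> None"
    then obtain y where "el p (i + int (Suc n)) = Some y" by blast
    then have "\<exists>x. el p (i + int (Suc n) - 1) = Some x" using el_step[of p "i + int (Suc n)" y] assms(1) by auto
    moreover have "i + int (Suc n) - 1 = i + int n" by simp
    ultimately show False using Suc by simp
  qed
qed (use assms in simp)

section \<open>Partition of the generators into strands\<close>

definition Bots where "Bots = {p. snd p \<in> Xs (fst p) \<and> (\<nexists>z. lk (fst p) (snd p) z)}"

lemma el_Xs:
  assumes "p \<in> Bots" "el p i = Some x"
  shows "x \<in> Xs i"
proof (cases "fst p = i")
  case True
  then show ?thesis using assms el_base[of p] by (simp add: Bots_def)
next
  case False
  then have "fst p < i" using el_low[OF assms(2)] by simp
  then show ?thesis using el_step assms(2) lk_Xs(1) by blast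
qed

text \<open>Descending along links must stop, because there are no generators below degree
  \<open>N\<close>. This is where boundedness below enters the splitting into strands.\<close>

lemma el_cover: "x \<in> Xs i \<Longrightarrow> \<exists>p\<in>Bots. el p i = Some x"
proof (induction "nat (i - N)" arbitrary: i x)
  case (0 i x)
  show ?case
  proof (cases "\<exists>z. lk i x z")
    case True
    then obtain z where "z \<in> Xs (i - 1)" using lk_Xs(2) by blast
    then show ?thesis using 0 low[of "i - 1"] by (simp add: Xs_def)
  next
    case False
    then have "(i, x) \<in> Bots" using 0 by (simp add: Bots_def)
    then show ?thesis using el_base[of "(i, x)"] by auto
  qed
next
  case (Suc n i x)
  show ?case
  proof (cases "\<exists>z. lk i x z")
    case True
    then obtain z where z: "lk i x z" by blast
    have "n = nat (i - 1 - N)" using Suc.hyps(2) by simp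
    then obtain p where p: "p \<in> Bots" "el p (i - 1) = Some z" using Suc.hyps(1) lk_Xs(2)[OF z] by blast
    then have "el p i = Some x" using el_step[of p i x] el_low[OF p(2)] z by auto
    then show ?thesis using p by blast
  next
    case False
    then have "(i, x) \<in> Bots" using Suc.prems by (simp add: Bots_def)
    then show ?thesis using el_base[of "(i, x)"] by auto
  qed
qed

text \<open>Descent is deterministic by \<open>lk_down\<close>, and a bottom has no link downwards,
  so two strands through one generator reach their bottoms simultaneously.\<close>

lemma el_inj: "p \<in> Bots \<Longrightarrow> q \<in> Bots \<Longrightarrow> el p i = Some x \<Longrightarrow> el q i = Some x \<Longrightarrow> p = q"
proof (induction "nat (i - fst p)" arbitrary: i x)
  case (0 i x)
  then have i: "fst p = i" using el_low[of p i x] by simp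
  then have x: "snd p = x" using 0(4) el_base[of p] by simp
  have "fst q = i"
  proof (rule ccontr)
    assume "fst q \<noteq> i"
    then have "\<exists>z. lk i x z" using el_step[of q i x] el_low[of q i x] 0(5) by auto
    then show False using 0(2) i x by (auto simp: Bots_def)
  qed
  then show ?case using el_base[of q] 0(5) i x by (simp add: prod_eq_iff)
next
  case (Suc n i x)
  have "fst p < i" using Suc.hyps(2) by simp
  then obtain z where z: "el p (i - 1) = Some z" "lk i x z" using el_step Suc.prems(3) by blast
  have "fst q \<noteq> i"
  proof
    assume "fst q = i"
    then have "snd q = x" using Suc.prems(4) el_base[of q] by simp
    then show False using Suc.prems(2) z(2) \<open>fst q = i\<close> by (auto simp: Bots_def)
  qed
  then have "fst q < i" using el_low[OF Suc.prems(4)] by simp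
  then obtain z' where z': "el q (i - 1) = Some z'" "lk i x z'" using el_step Suc.prems(4) by blast
  then have "z' = z" using lk_down z(2) by blast
  moreover have "n = nat (i - 1 - fst p)" using Suc.hyps(2) by simp
  ultimately show ?case using Suc.hyps(1)[of "i - 1" z] Suc.prems(1,2) z z' by blast
qed

lemma countable_Bots: "countable Bots"
proof (rule countable_subset)
  show "Bots \<subseteq> (SIGMA s:UNIV. Xs s)" by (auto simp: Bots_def)
  show "countable (SIGMA s:UNIV. Xs s)" using finite_Xs by (intro countable_SIGMA) (auto simp: countable_finite)
qed

definition shp where
  "shp p i = (case el p i of None \<Rightarrow> SZ | Some x \<Rightarrow> if x \<in> io i ` E i then SF else SH)"

text \<open>The shapes determine all differentials except for \<open>F \<rightarrow> F\<close>, which is the identity only in \<open>KDF\<close>.\<close>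

definition of_kind where
  "of_kind p \<kappa> s \<longleftrightarrow> (\<forall>i. kshape \<kappa> (i - s) = shp p i) \<and>
     (\<forall>i x z. el p i = Some x \<longrightarrow> el p (i - 1) = Some z \<longrightarrow> x \<in> io i ` E i \<longrightarrow> z \<in> io (i - 1) ` E (i - 1) \<longrightarrow>
        dT i (ep i x) = (if \<kappa> = KDF then ep (i - 1) z else rho (i - 1) z))"

text \<open>An identity between copies of \<open>F\<close> fills its whole strand. Nothing hits the
  upper generator \<open>x\<close>, as \<open>dB i x \<noteq> 0\<close>. The lower generator
  \<open>z\<close> has no link: \<open>d\<close> squaring to zero makes both \<open>dB\<close> of
  \<open>z\<close> and \<open>dT\<close> of its lift vanish. In a strand without such an identity
  all maps between copies of \<open>F\<close> are \<open>u\<close>, and the shapes decide.\<close>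

lemma strand_kind:
  assumes p: "p \<in> Bots"
  shows "\<exists>\<kappa> s. of_kind p \<kappa> s"
proof (cases "\<exists>i x z. el p i = Some x \<and> el p (i - 1) = Some z \<and> x \<in> io i ` E i \<and>
    z \<in> io (i - 1) ` E (i - 1) \<and> dT i (ep i x) = ep (i - 1) z")
  case True
  then obtain i x z where x: "el p i = Some x" "el p (i - 1) = Some z" "x \<in> io i ` E i"
    "z \<in> io (i - 1) ` E (i - 1)" "dT i (ep i x) = ep (i - 1) z" by blast
  have zX: "z \<in> Xs (i - 1)" using el_Xs[OF p x(2)] .
  have dBx: "dB i x = z" using dB_io[OF ep(2)[OF x(3)]] x(5) ep(3)[OF x(3)] ep(3)[OF x(4)] by simp
  have lkx: "lk i x z" using el_stepD[OF x(1,2)] .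
  have fp: "fst p = i - 1"
  proof (rule ccontr)
    assume "fst p \<noteq> i - 1"
    then have "fst p < i - 1" using el_low[OF x(2)] by simp
    then obtain w where w: "lk (i - 1) z w" using el_step[of p "i - 1" z] x(2) by blast
    have wX: "w \<in> Xs (i - 1 - 1)" using lk_Xs(2)[OF w] .
    show False using w
    proof (cases rule: lk_cases)
      case u
      have "dT (i - 1) (ep (i - 1) z) = 0" using dT_dT[OF ep(2)[OF x(3)]] x(5) by simp
      then have "rho (i - 1 - 1) w = rho (i - 1 - 1) 0" using u rho_0 by simp
      then have "w = 0" using rho_inj[OF Xs_B[OF wX] f2_zero[OF B_f2]] by blast
      then show False using Xs_nz[OF wX] by blast
    qed (use lk_dB_zero[OF lkx] Xs_nz[OF wX] in auto)
  qed
  have top: "el p (i + 1) = None"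
  proof (rule ccontr)
    assume "el p (i + 1) \<noteq> None"
    then obtain y where "el p (i + 1) = Some y" by blast
    then have "lk (i + 1) y x" using el_stepD[of p "i + 1" y x] x(1) by simp
    then have "dB i x = 0" using lk_dB_zero[of "i + 1" y x] by simp
    then show False using dBx Xs_nz[OF zX] by simp
  qed
  have high: "el p k = None" if "k > i" for k
    using el_None_up[OF _ top, of "nat (k - (i + 1))"] fp that by simp
  have lowN: "el p k = None" if "k < i - 1" for k using that fp by (simp add: el_def)
  have "kshape KDF (k - (i - 1)) = shp p k" for k
  proof -
    consider "k < i - 1" | "k = i - 1" | "k = i" | "k > i" by linarith
    then show ?thesis
    proof cases
      case 1
      then show ?thesis using lowN by (simp add: shp_def)
    next
      case 2
      then show ?thesis using x by (simp add: shp_def)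
    next
      case 3
      then show ?thesis using x by (simp add: shp_def)
    next
      case 4
      then show ?thesis using high by (simp add: shp_def)
    qed
  qed
  moreover have "k = i \<and> a = x \<and> b = z" if "el p k = Some a" "el p (k - 1) = Some b" for k a b
  proof -
    have "\<not> k > i" using high that(1) by force
    moreover have "\<not> k - 1 < i - 1" using lowN that(2) by force
    ultimately have "k = i" by simp
    then show ?thesis using that x(1,2) by simp
  qed
  then have "dT k (ep k a) = ep (k - 1) b" if "el p k = Some a" "el p (k - 1) = Some b" for k a b
    using that x(5) by blast
  ultimately have "of_kind p KDF (i - 1)" unfolding of_kind_def by simp
  then show ?thesis by blast
next
  case False
  define s where "s = fst p"
  define sh where "sh n = shp p (s + int n)" for n
  have "\<exists>\<kappa> t. \<kappa> \<noteq> KDF \<and> (\<forall>i. kshape \<kappa> (i - t) = (if i < 0 then SZ else sh (nat i)))"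
  proof (rule kind_of_shape)
    show "sh 0 \<noteq> SZ" using el_base[of p] by (simp add: sh_def shp_def s_def)
    show "sh (Suc n) = SZ" if "sh n = SZ" for n
    proof -
      have "el p (s + int n) = None" using that by (auto simp: sh_def shp_def split: option.splits if_splits)
      then have "el p (s + int n + int 1) = None" by (rule el_None_up[rotated]) (simp add: s_def)
      then show ?thesis by (simp add: sh_def shp_def algebra_simps)
    qed
    \<comment> \<open>A copy of \<open>H\<close> above the bottom has a link downwards, hence
      nonzero \<open>dB\<close>, and cannot be hit.\<close>
    show "sh (Suc (Suc n)) = SZ" if SH: "sh (Suc n) = SH" for n
    proof (rule ccontr)
      define i where "i = s + int (Suc n)"
      assume "sh (Suc (Suc n)) \<noteq> SZ"
      then obtain y where y: "el p (i + 1) = Some y"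
        by (auto simp: sh_def shp_def i_def algebra_simps split: option.splits)
      have "shp p i = SH" using SH by (simp add: sh_def i_def)
      then obtain x where x: "el p i = Some x" "x \<notin> io i ` E i"
        by (auto simp: shp_def split: option.splits if_splits)
      have "fst p < i" by (simp add: i_def s_def)
      then obtain z where z: "lk i x z" using el_step x(1) by blast
      have "lk (i + 1) y x" using el_stepD[of p "i + 1" y x] y x by simp
      then have "dB i x = 0" using lk_dB_zero[of "i + 1" y x] by simp
      moreover have "dB i x = z" using z by (cases rule: lk_cases) (use x(2) in auto)
      ultimately show False using Xs_nz[OF lk_Xs(2)[OF z]] by simp
    qed
  qed
  then obtain \<kappa> t where \<kappa>: "\<kappa> \<noteq> KDF" "\<And>i. kshape \<kappa> (i - t) = (if i < 0 then SZ else sh (nat i))" by blast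
  have "kshape \<kappa> (i - (s + t)) = shp p i" for i
  proof -
    have "kshape \<kappa> (i - (s + t)) = (if i - s < 0 then SZ else sh (nat (i - s)))"
      using \<kappa>(2)[of "i - s"] by (simp add: algebra_simps)
    also have "\<dots> = shp p i" by (auto simp: sh_def shp_def el_def s_def)
    finally show ?thesis .
  qed
  moreover have "dT i (ep i x) = rho (i - 1) z"
    if x: "el p i = Some x" "el p (i - 1) = Some z" "x \<in> io i ` E i" "z \<in> io (i - 1) ` E (i - 1)" for i x z
    using el_stepD[OF x(1,2)]
  proof (cases rule: lk_cases)
    case id
    then show ?thesis using False x by blast
  next
    case u
    then show ?thesis by simp
  next
    case h
    then show ?thesis using EG_disj x(3) by blast
  qed
  ultimately have "of_kind p \<kappa> (s + t)" using \<kappa>(1) unfolding of_kind_def by simp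
  then show ?thesis by blast
qed

section \<open>The differential on a single strand and the isomorphism\<close>

definition termT where
  "termT p i a = (case el p i of None \<Rightarrow> 0 | Some x \<Rightarrow> coefT i (E i) x a)"
definition termB where
  "termB p i c = (case el p i of None \<Rightarrow> 0 | Some x \<Rightarrow> bsm c x)"

lemma dT_coefT:
  assumes "x \<in> Xs i"
  shows "dT i (coefT i (E i) x a) = (if x \<in> io i ` E i
    then bsm (fst a) (dT i (ep i x)) + bsm (snd a) (tr (C (i - 1)) (dT i (ep i x)))
    else bsm (fst a) (rho (i - 1) (dB i x)))"
proof (cases "x \<in> io i ` E i")
  case True
  note e = ep(2)[OF True]
  have "dT i (coefT i (E i) x a) = dT i (bsm (fst a) (ep i x)) + dT i (bsm (snd a) (tr (C i) (ep i x)))"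
    using True additive_onD[OF dT_add bsm_in[OF T_f2 e] bsm_in[OF T_f2 tr_in[OF e]]] by (simp add: coefT_def ep_def)
  then show ?thesis using True by (simp add: additive_bsm[OF T_f2 dT_add] dT_tr[OF e])
next
  case False
  then show ?thesis by (simp add: coefT_def additive_bsm[OF T_f2 dT_add] dT_rho[OF Xs_B[OF assms]])
qed

lemma term_diff:
  assumes p: "p \<in> Bots" and k: "of_kind p \<kappa> s"
  shows "a \<in> Top (shape_mod (kshape \<kappa> (i - s))) \<Longrightarrow>
      dT i (termT p i a) = termT p (i - 1) (fst (kdiff \<kappa> (i - s)) a)"
    and "c \<in> Bot (shape_mod (kshape \<kappa> (i - s))) \<Longrightarrow>
      dB i (termB p i c) = termB p (i - 1) (snd (kdiff \<kappa> (i - s)) c)"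
proof -
  have k1: "kshape \<kappa> (i - s) = shp p i" using k unfolding of_kind_def by blast
  have "kshape \<kappa> (i - 1 - s) = shp p (i - 1)" using k unfolding of_kind_def by blast
  moreover have "i - 1 - s = i - s - 1" by simp
  ultimately have k2: "kshape \<kappa> (i - s - 1) = shp p (i - 1)" by simp
  have *: "(a \<in> Top (shape_mod (shp p i)) \<longrightarrow> dT i (termT p i a) = termT p (i - 1) (fst (kdiff \<kappa> (i - s)) a)) \<and>
    (c \<in> Bot (shape_mod (shp p i)) \<longrightarrow> dB i (termB p i c) = termB p (i - 1) (snd (kdiff \<kappa> (i - s)) c))" for a c
  proof (cases "el p i")
    case None
    then have "shp p i = SZ" by (simp add: shp_def)
    moreover from this have "kdiff \<kappa> (i - s) = map_zero" by (simp add: kdiff_def k1)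
    moreover have "termT p (i - 1) 0 = 0" "termB p (i - 1) 0 = 0"
      by (auto simp: termT_def termB_def coefT_def split: option.split)
    ultimately show ?thesis using None by (simp add: termT_def termB_def map_zero_def dT_0 dB_0)
  next
    case (Some x)
    note x = this
    have xX: "x \<in> Xs i" using el_Xs[OF p x] .
    have tT: "termT p i a = coefT i (E i) x a" "termB p i c = bsm c x" using x by (simp_all add: termT_def termB_def)
    show ?thesis
    proof (cases "el p (i - 1)")
      case None
      have "fst p = i"
      proof (rule ccontr)
        assume "fst p \<noteq> i"
        then have "fst p < i" using el_low[OF x] by simp
        then show False using el_step x None by fastforce
      qed
      then have "snd p = x" using el_base[of p] x by simp
      then have "\<nexists>z. lk i x z" using p \<open>fst p = i\<close> by (auto simp: Bots_def)
      then consider "x \<in> io i ` E i" "dT i (ep i x) = 0" | "x \<in> G i" "dB i x = 0" using lk_or_zero[OF xX] by blast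
      then have "dT i (termT p i a) = 0 \<and> dB i (termB p i c) = 0"
      proof cases
        case 1
        have "dB i x = 0" using dB_io[OF ep(2)[OF 1(1)]] 1 ep(3)[OF 1(1)] io_0 by simp
        then show ?thesis
          using 1 additive_zero[OF T_f2 tr_add] by (simp add: tT dT_coefT[OF xX] additive_bsm[OF B_f2 dB_add])
      next
        case 2
        then have "x \<notin> io i ` E i" using EG_disj by blast
        then show ?thesis using 2 by (simp add: tT dT_coefT[OF xX] additive_bsm[OF B_f2 dB_add] rho_0)
      qed
      then show ?thesis using None by (simp add: termT_def termB_def)
    next
      case (Some z)
      have lkx: "lk i x z" using el_stepD[OF x Some] .
      have k3: "dT i (ep i x) = (if \<kappa> = KDF then ep (i - 1) z else rho (i - 1) z)"
        if "x \<in> io i ` E i" "z \<in> io (i - 1) ` E (i - 1)"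
        using conjunct2[OF k[unfolded of_kind_def], rule_format, OF x Some that] .
      have zX: "z \<in> Xs (i - 1)" using el_Xs[OF p Some] .
      note zB = Xs_B[OF zX]
      have tT': "termT p (i - 1) a = coefT (i - 1) (E (i - 1)) z a" "termB p (i - 1) c = bsm c z" for a c
        using Some by (simp_all add: termT_def termB_def)
      \<comment> \<open>In coordinates \<open>rho z\<close> is \<open>(1, 1)\<close> on
        \<open>F\<close> and \<open>(1, 0)\<close> on \<open>H\<close>; this produces the formulas
        defining \<open>map_u\<close>, \<open>map_pFH\<close> and \<open>map_pHF\<close>.\<close>
      have rb: "bsm c (rho (i - 1) z) =
          coefT (i - 1) (E (i - 1)) z (if z \<in> io (i - 1) ` E (i - 1) then (c, c) else (c, 0))" for c
        using rho_bsm[OF g zX[unfolded Xs_def]] additive_bsm[OF B_f2 rho_add] by metis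
      show ?thesis
      proof (cases "x \<in> io i ` E i")
        case xE: True
        then have s1: "shp p i = SF" using x by (simp add: shp_def)
        show ?thesis
        proof (cases "\<kappa> = KDF \<and> z \<in> io (i - 1) ` E (i - 1)")
          case True
          then have s2: "shp p (i - 1) = SF" using Some by (simp add: shp_def)
          have dx: "dT i (ep i x) = ep (i - 1) z" using k3[OF xE] True by simp
          have "kdiff \<kappa> (i - s) = map_id" unfolding kdiff_def k1 k2 s1 s2 using True by simp
          moreover have "dB i x = z" using dB_io[OF ep(2)[OF xE]] dx ep(3)[OF xE] ep(3)[of z "i - 1"] True by simp
          moreover have "coefT (i - 1) (E (i - 1)) z a =
              bsm (fst a) (ep (i - 1) z) + bsm (snd a) (tr (C (i - 1)) (ep (i - 1) z))"
            using True unfolding coefT_def ep_def by simp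
          moreover have "dT i (coefT i (E i) x a) =
              bsm (fst a) (ep (i - 1) z) + bsm (snd a) (tr (C (i - 1)) (ep (i - 1) z))"
            unfolding dT_coefT[OF xX] dx using xE by simp
          ultimately show ?thesis
            by (simp add: tT tT' additive_bsm[OF B_f2 dB_add] map_id_def)
        next
          case False
          have dx: "dT i (ep i x) = rho (i - 1) z" using lkx
          proof (cases rule: lk_cases)
            case id
            then show ?thesis using k3 False by simp
          next
            case u
            then show ?thesis by simp
          next
            case h
            then show ?thesis using EG_disj xE by blast
          qed
          have dBx: "dB i x = 0" using dB_io[OF ep(2)[OF xE]] dx ep(3)[OF xE] io_rho[OF zB] by simp
          have l: "dT i (termT p i a) = bsm (fst a + snd a) (rho (i - 1) z)" "dB i (termB p i c) = 0"
            using xE by (simp_all add: tT dT_coefT[OF xX] dx tr_rho[OF zB] bsm_add[OF T_f2 rho_in[OF zB]]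
                additive_bsm[OF B_f2 dB_add] dBx)
          show ?thesis
          proof (cases "z \<in> io (i - 1) ` E (i - 1)")
            case True
            then have "shp p (i - 1) = SF" using Some by (simp add: shp_def)
            then have "kdiff \<kappa> (i - s) = map_u" using True False by (simp add: kdiff_def k1 k2 s1)
            then show ?thesis using True by (simp add: l rb tT' map_u_def case_prod_beta)
          next
            case False
            then have "shp p (i - 1) = SH" using Some by (simp add: shp_def)
            then have "kdiff \<kappa> (i - s) = map_pFH" by (simp add: kdiff_def k1 k2 s1)
            then show ?thesis using False by (simp add: l rb tT' map_pFH_def case_prod_beta)
          qed
        qed
      next
        case xG: False
        then have s1: "shp p i = SH" using x by (simp add: shp_def)
        have dBx: "dB i x = z" using lkx by (cases rule: lk_cases) (use xG in auto)
        have l: "dT i (termT p i a) = bsm (fst a) (rho (i - 1) z)" "dB i (termB p i c) = bsm c z"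
          using xG by (simp_all add: tT dT_coefT[OF xX] dBx additive_bsm[OF B_f2 dB_add])
        show ?thesis
        proof (cases "z \<in> io (i - 1) ` E (i - 1)")
          case True
          then have "shp p (i - 1) = SF" using Some by (simp add: shp_def)
          then have "kdiff \<kappa> (i - s) = map_pHF" by (simp add: kdiff_def k1 k2 s1)
          then show ?thesis using True by (simp add: l rb tT' map_pHF_def case_prod_beta)
        next
          case False
          then have "shp p (i - 1) = SH" using Some by (simp add: shp_def)
          then have "kdiff \<kappa> (i - s) = map_id" by (simp add: kdiff_def k1 k2 s1)
          then show ?thesis using False by (auto simp add: l rb tT' map_id_def s1)
        qed
      qed
    qed
  qed
  show "a \<in> Top (shape_mod (kshape \<kappa> (i - s))) \<Longrightarrow>
      dT i (termT p i a) = termT p (i - 1) (fst (kdiff \<kappa> (i - s)) a)"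
    "c \<in> Bot (shape_mod (kshape \<kappa> (i - s))) \<Longrightarrow>
      dB i (termB p i c) = termB p (i - 1) (snd (kdiff \<kappa> (i - s)) c)"
    using * unfolding k1 by blast+
qed

lemma decomposition:
  "\<exists>(J :: nat set) \<kappa> \<sigma> f. complex_iso C d (std_sum_mod J \<kappa> \<sigma>) (std_sum_diff J \<kappa> \<sigma>) f"
proof -
  obtain K S where KS: "\<And>p. p \<in> Bots \<Longrightarrow> of_kind p (K p) (S p)" using strand_kind by metis
  \<comment> \<open>Each degree has finitely many generators, so there are countably many strands,
    and an injective numbering by naturals gives the index set.\<close>
  define J where "J = to_nat_on Bots ` Bots"
  define st where "st = from_nat_into Bots"
  define \<kappa> where "\<kappa> j = K (st j)" for j
  define \<sigma> where "\<sigma> j = S (st j)" for j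
  have st: "st j \<in> Bots" "to_nat_on Bots (st j) = j" if "j \<in> J" for j
    using that countable_Bots by (auto simp: J_def st_def)
  have st_J: "\<exists>j\<in>J. st j = p" if "p \<in> Bots" for p
    using that countable_Bots by (auto simp: J_def st_def)
  define I where "I i = {j \<in> J. el (st j) i \<noteq> None}" for i
  define xx where "xx i j = the (el (st j) i)" for i j
  have elI: "el (st j) i = Some (xx i j)" if "j \<in> I i" for i j using that by (auto simp: I_def xx_def)
  have bij: "bij_betw (xx i) (I i) (Xs i)" for i
  proof (rule bij_betw_imageI)
    show "inj_on (xx i) (I i)"
    proof (rule inj_onI)
      fix j j' assume jj: "j \<in> I i" "j' \<in> I i" "xx i j = xx i j'"
      then have "j \<in> J" "j' \<in> J" by (auto simp: I_def)
      moreover from this have "st j = st j'"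
        using el_inj[of "st j" "st j'" i "xx i j"] st(1) elI[OF jj(1)] elI[OF jj(2)] jj(3) by simp
      ultimately show "j = j'" using st(2) by metis
    qed
    show "xx i ` I i = Xs i"
    proof
      show "xx i ` I i \<subseteq> Xs i"
      proof
        fix x assume "x \<in> xx i ` I i"
        then obtain j where j: "j \<in> I i" "x = xx i j" by blast
        then show "x \<in> Xs i" using el_Xs[OF st(1) elI[OF j(1)]] by (simp add: I_def)
      qed
      show "Xs i \<subseteq> xx i ` I i"
      proof
        fix x assume "x \<in> Xs i"
        then obtain p where p: "p \<in> Bots" "el p i = Some x" using el_cover by blast
        then obtain j where j: "j \<in> J" "st j = p" using st_J by blast
        then have "j \<in> I i" "xx i j = x" using p by (auto simp: I_def xx_def)
        then show "x \<in> xx i ` I i" by blast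
      qed
    qed
  qed
  have finI: "finite (I i)" for i using bij_betw_finite[OF bij] finite_Xs by blast
  define m where "m i j = (if j \<in> J then shape_mod (kshape (\<kappa> j) (i - \<sigma> j)) else zZ)" for i j
  have ks: "kshape (\<kappa> j) (i - \<sigma> j) = shp (st j) i" if "j \<in> J" for i j
    using KS[OF st(1)[OF that]] unfolding of_kind_def \<kappa>_def \<sigma>_def by blast
  have m: "m i j = (if j \<in> I i then if xx i j \<in> io i ` E i then zF else zH else zZ)" for i j
    by (auto simp: m_def ks shp_def I_def xx_def split: option.split)
  have sm: "std_sum_mod J \<kappa> \<sigma> i = dsum (m i)" for i
    unfolding std_sum_mod_def by (rule arg_cong[where f = dsum]) (simp add: fun_eq_iff m_def)
  have fam: "FH_family (m i)" for i
  proof -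
    have "{j. m i j \<noteq> zZ} \<subseteq> I i" unfolding m by auto
    then show ?thesis unfolding FH_family_def using finite_subset[OF _ finI] by (auto simp: m)
  qed
  define fT where "fT i v = (\<Sum>j\<in>I i. coefT i (E i) (xx i j) (v j))" for i v
  define fB where "fB i w = (\<Sum>j\<in>I i. bsm (w j) (xx i j))" for i w
  have iso: "ziso (dsum (m i)) (C i) (fT i, fB i)" for i
    unfolding fT_def fB_def by (rule dsum_iso[OF g finI bij[unfolded Xs_def] m])
  define dlT where "dlT i = fst (std_sum_diff J \<kappa> \<sigma> i)" for i
  define dlB where "dlB i = snd (std_sum_diff J \<kappa> \<sigma> i)" for i
  have dlT: "dlT i v j = (if j \<in> J then fst (kdiff (\<kappa> j) (i - \<sigma> j)) (v j) else 0)" for i v j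
    by (simp add: dlT_def std_sum_diff_def)
  have dlB: "dlB i w j = (if j \<in> J then snd (kdiff (\<kappa> j) (i - \<sigma> j)) (w j) else 0)" for i w j
    by (simp add: dlB_def std_sum_diff_def)
  have shift: "i - 1 - \<sigma> j = i - \<sigma> j - 1" for i j by simp
  have dlT_in: "dlT i v \<in> Top (dsum (m (i - 1)))" if "v \<in> Top (dsum (m i))" for i v
  proof -
    have "dlT i v j \<in> Top (m (i - 1) j)" for j
    proof (cases "j \<in> J")
      case True
      have "v j \<in> Top (m i j)" using that unfolding FH_Top[OF fam] by blast
      then show ?thesis using True kdiff_closed(1)[of "v j" "\<kappa> j" "i - \<sigma> j"] by (simp add: dlT m_def shift)
    qed (simp add: dlT m_def)
    then show ?thesis unfolding FH_Top[OF fam] by blast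
  qed
  have dlB_in: "dlB i w \<in> Bot (dsum (m (i - 1)))" if "w \<in> Bot (dsum (m i))" for i w
  proof -
    have "dlB i w j \<in> Bot (m (i - 1) j)" for j
    proof (cases "j \<in> J")
      case True
      have "w j \<in> Bot (m i j)" using that unfolding FH_Bot[OF fam] by blast
      then show ?thesis using True kdiff_closed(2)[of "w j" "\<kappa> j" "i - \<sigma> j"] by (simp add: dlB m_def shift)
    qed (simp add: dlB m_def)
    then show ?thesis unfolding FH_Bot[OF fam] by blast
  qed
  have term0: "termT (st j) i a = 0" "termB (st j) i c = 0" if "j \<in> J" "j \<notin> I i" for i j a c
    using that by (simp_all add: termT_def termB_def I_def)
  have term1: "coefT i (E i) (xx i j) a = termT (st j) i a" "bsm c (xx i j) = termB (st j) i c"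
    if "j \<in> I i" for i j a c
    using elI[OF that] by (simp_all add: termT_def termB_def)
  have fT_term: "fT i v = (\<Sum>j\<in>L. termT (st j) i (v j))" if "I i \<subseteq> L" "L \<subseteq> J" "finite L" for i v L
    unfolding fT_def
    by (rule sum.mono_neutral_cong_left[OF that(3,1)]) (use that(2) term0(1) term1(1) in blast)+
  have fB_term: "fB i w = (\<Sum>j\<in>L. termB (st j) i (w j))" if "I i \<subseteq> L" "L \<subseteq> J" "finite L" for i w L
    unfolding fB_def
    by (rule sum.mono_neutral_cong_left[OF that(3,1)]) (use that(2) term0(2) term1(2) in blast)+
  have IJ: "I i \<subseteq> J" for i by (auto simp: I_def)
  have tT_in: "termT (st j) i a \<in> T i" if "j \<in> J" for i j a
  proof (cases "j \<in> I i")
    case True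
    have "xx i j \<in> Xs i" using el_Xs[OF st(1)[OF that] elI[OF True]] .
    then show ?thesis using coefT_in[OF g] term1(1)[OF True] unfolding Xs_def by metis
  next
    case False
    then show ?thesis using term0(1)[OF that] f2_zero[OF T_f2] by simp
  qed
  have tB_in: "termB (st j) i c \<in> B i" if "j \<in> J" for i j c
  proof (cases "j \<in> I i")
    case True
    have "xx i j \<in> B i" using Xs_B[OF el_Xs[OF st(1)[OF that] elI[OF True]]] .
    then show ?thesis using bsm_in[OF B_f2] term1(2)[OF True] by metis
  next
    case False
    then show ?thesis using term0(2)[OF that] f2_zero[OF B_f2] by simp
  qed
  have commT: "dT i (fT i v) = fT (i - 1) (dlT i v)" if v: "v \<in> Top (dsum (m i))" for i v
  proof -
    \<comment> \<open>A strand may live in only one of the two degrees. Summing over the strands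
      meeting either, with zero terms elsewhere, allows a comparison term by term.\<close>
    let ?L = "I i \<union> I (i - 1)"
    have L: "?L \<subseteq> J" "finite ?L" using IJ finI by auto
    have "dT i (fT i v) = dT i (\<Sum>j\<in>?L. termT (st j) i (v j))" using fT_term[of i ?L] L by simp
    also have "\<dots> = (\<Sum>j\<in>?L. dT i (termT (st j) i (v j)))"
      by (rule additive_sum[OF T_f2 dT_add]) (use tT_in L(1) in blast)
    also have "\<dots> = (\<Sum>j\<in>?L. termT (st j) (i - 1) (dlT i v j))"
    proof (rule sum.cong)
      fix j assume "j \<in> ?L"
      then have j: "j \<in> J" using L by blast
      have "v j \<in> Top (m i j)" using v unfolding FH_Top[OF fam] by blast
      then have "v j \<in> Top (shape_mod (kshape (K (st j)) (i - S (st j))))" using j by (simp add: m_def \<kappa>_def \<sigma>_def)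
      then show "dT i (termT (st j) i (v j)) = termT (st j) (i - 1) (dlT i v j)"
        using term_diff(1)[OF st(1)[OF j] KS[OF st(1)[OF j]]] j by (simp add: dlT \<kappa>_def \<sigma>_def)
    qed simp
    also have "\<dots> = fT (i - 1) (dlT i v)" using fT_term[of "i - 1" ?L] L by simp
    finally show ?thesis .
  qed
  have commB: "dB i (fB i w) = fB (i - 1) (dlB i w)" if w: "w \<in> Bot (dsum (m i))" for i w
  proof -
    let ?L = "I i \<union> I (i - 1)"
    have L: "?L \<subseteq> J" "finite ?L" using IJ finI by auto
    have "dB i (fB i w) = dB i (\<Sum>j\<in>?L. termB (st j) i (w j))" using fB_term[of i ?L] L by simp
    also have "\<dots> = (\<Sum>j\<in>?L. dB i (termB (st j) i (w j)))"
      by (rule additive_sum[OF B_f2 dB_add]) (use tB_in L(1) in blast)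
    also have "\<dots> = (\<Sum>j\<in>?L. termB (st j) (i - 1) (dlB i w j))"
    proof (rule sum.cong)
      fix j assume "j \<in> ?L"
      then have j: "j \<in> J" using L by blast
      have "w j \<in> Bot (m i j)" using w unfolding FH_Bot[OF fam] by blast
      then have "w j \<in> Bot (shape_mod (kshape (K (st j)) (i - S (st j))))" using j by (simp add: m_def \<kappa>_def \<sigma>_def)
      then show "dB i (termB (st j) i (w j)) = termB (st j) (i - 1) (dlB i w j)"
        using term_diff(2)[OF st(1)[OF j] KS[OF st(1)[OF j]]] j by (simp add: dlB \<kappa>_def \<sigma>_def)
    qed simp
    also have "\<dots> = fB (i - 1) (dlB i w)" using fB_term[of "i - 1" ?L] L by simp
    finally show ?thesis .
  qed
  have bT: "bij_betw (fT i) (Top (dsum (m i))) (T i)" and bB: "bij_betw (fB i) (Bot (dsum (m i))) (B i)" for i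
    using iso[of i] by (simp_all add: ziso_def)
  \<comment> \<open>The coordinate maps run from the standard sum to \<open>C\<close>, so the
    required isomorphism consists of their inverses.\<close>
  let ?gT = "\<lambda>i. inv_into (Top (dsum (m i))) (fT i)" and ?gB = "\<lambda>i. inv_into (Bot (dsum (m i))) (fB i)"
  have "complex_iso C d (std_sum_mod J \<kappa> \<sigma>) (std_sum_diff J \<kappa> \<sigma>) (\<lambda>i. (?gT i, ?gB i))"
    unfolding complex_iso_def
  proof (intro conjI allI ballI)
    fix i
    show "ziso (C i) (std_sum_mod J \<kappa> \<sigma> i) (?gT i, ?gB i)" using ziso_inv[OF fam iso[of i]] by (simp add: sm)
  next
    fix i x assume x: "x \<in> T i"
    define v where "v = ?gT i x"
    have v: "v \<in> Top (dsum (m i))" "fT i v = x"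
      using bT[of i] x unfolding v_def bij_betw_def by (simp_all add: inv_into_into f_inv_into_f)
    have "?gT (i - 1) (dT i x) = ?gT (i - 1) (fT (i - 1) (dlT i v))" using commT[OF v(1)] v(2) by simp
    also have "\<dots> = dlT i v" using inv_into_f_f[OF bij_betw_imp_inj_on[OF bT] dlT_in[OF v(1)]] .
    finally show "fst (?gT (i - 1), ?gB (i - 1)) (dT i x) =
        fst (std_sum_diff J \<kappa> \<sigma> i) (fst (?gT i, ?gB i) x)" by (simp add: v_def dlT_def)
  next
    fix i x assume x: "x \<in> B i"
    define w where "w = ?gB i x"
    have w: "w \<in> Bot (dsum (m i))" "fB i w = x"
      using bB[of i] x unfolding w_def bij_betw_def by (simp_all add: inv_into_into f_inv_into_f)
    have "?gB (i - 1) (dB i x) = ?gB (i - 1) (fB (i - 1) (dlB i w))" using commB[OF w(1)] w(2) by simp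
    also have "\<dots> = dlB i w" using inv_into_f_f[OF bij_betw_imp_inj_on[OF bB] dlB_in[OF w(1)]] .
    finally show "snd (?gT (i - 1), ?gB (i - 1)) (dB i x) =
        snd (std_sum_diff J \<kappa> \<sigma> i) (snd (?gT i, ?gB i) x)" by (simp add: w_def dlB_def)
  qed
  then show ?thesis by blast
qed

end

theorem theorem4p10:
  fixes C :: "int \<Rightarrow> ('a::ab_group_add, 'b::ab_group_add) zmod"
    and d :: "int \<Rightarrow> ('a \<Rightarrow> 'a) \<times> ('b \<Rightarrow> 'b)"
  assumes "is_complex C d"
    and "bounded_below C"
    and "\<forall>i. fin_FH (C i)"
  shows "\<exists>(J :: nat set) (\<kappa> :: nat \<Rightarrow> kind) (\<sigma> :: nat \<Rightarrow> int) f.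
           complex_iso C d (std_sum_mod J \<kappa> \<sigma>) (std_sum_diff J \<kappa> \<sigma>) f"
proof -
  interpret nice_complex C d
  proof
    show "nice (C i)" for i using assms(1,3) fin_FH_nice unfolding is_complex_def by blast
  qed (rule assms(1))
  obtain N where N: "\<And>i. i < N \<Longrightarrow> Top (C i) = {0} \<and> Bot (C i) = {0}"
    using assms(2) unfolding bounded_below_def by blast
  obtain E G where EG: "\<And>k. gens k (E k) (G k)" "\<And>k. linked k (E k) (G k) (E (k - 1)) (G (k - 1))"
    using linked_family[OF N] by blast
  interpret strand_complex C d E G N
  proof
    show "E i = {} \<and> G i = {}" if "i < N" for i using gens_trivial EG(1) N[OF that] by blast
  qed (rule EG)+
  show ?thesis by (rule decomposition)
qed

end
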